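(* Let $n\ge 1$. The linear map $\phi:V^{\mathcal{T}_n}\to V^{\mathcal{W}_n}$, defined on the basis of Specht vectors by $\phi(v_T)=\sigma\cdot w_0$ where $\sigma$ labels a directed path from $T_0$ to $T$ in the tableau graph, is $S_{2n}$-equivariant, and it is, up to scaling, the only $S_{2n}$-equivariant isomorphism $V^{\mathcal{T}_n}\to V^{\mathcal{W}_n}$.
   Context: $\mathcal{T}_n$ is the set of standard Young tableaux of shape $(n,n)$ ($2\times n$ fillings with $1,\dots,2n$, increasing along rows and down columns). $s_i\in S_{2n}$ is the transposition of $i$ and $i+1$; $S_{2n}$ acts on tableaux by permuting entries. Specht module: a tabloid $\{T\}$ is the equivalence class of a tableau $T$ under reordering entries within rows. For any tableau $T$ of shape $(n,n)$, the Specht vector is $v_T=\sum_{\sigma\in Col(T)}\mathrm{sign}(\sigma)\{\sigma\cdot T\}$, where $Col(T)$ is the group of permutations preserving each column of $T$ setwise. $V^{\mathcal{T}_n}$ is the complex span of all the Specht vectors; it has basis $\{v_T: T\in\mathcal{T}_n\}$, and $S_{2n}$ acts on it by $\sigma\cdot v_T=v_{\sigma\cdot T}$. A web on $2n$ points is a noncrossing perfect matching of $1,\dots,2n$ (arcs above a horizontal axis); $(i,j)$ denotes an arc with endpoints $i<j$, and $\{i,j\}$ an arc whose endpoints are not necessarily listed in order. $\mathcal{W}_n$ is the set of webs and $V^{\mathcal{W}_n}$ the complex vector space with basis $\mathcal{W}_n$, with the $S_{2n}$-action: $s_i\cdot w=-w$ if $(i,i+1)$ is an arc of $w$; otherwise,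 if $w$ contains $\{i,j\}$ and $\{i+1,k\}$, then $s_i\cdot w=w+w'$ where $w'$ is obtained from $w$ by replacing these two arcs by $(i,i+1)$ and $\{j,k\}$. It is known that this is a well-defined irreducible representation, isomorphic to $V^{\mathcal{T}_n}$. Tableau graph: directed graph on $\mathcal{T}_n$ with an edge $T\stackrel{s_i}{\longrightarrow}T'$ iff $s_i\cdot T=T'$ and $i$ is in the second row and $i+1$ in the first row of $T$. $T_0\in\mathcal{T}_n$ is the tableau with top row $1,3,\dots,2n-1$ and bottom row $2,4,\dots,2n$; $w_0$ is the web with arcs $(1,2),(3,4),\dots,(2n-1,2n)$. In the definition of $\phi$, $\sigma$ is the product of the edge labels of the directed path from $T_0$ to $T$, composed so that $\sigma\cdot T_0=T$ (the label of the first edge acts first). There is a directed path from $T_0$ to every $T\in\mathcal{T}_n$, and $\phi(v_T)$ does not depend on the choice of path. *)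

theory Defs
  imports
    Complex_Main
    "HOL-Library.FuncSet"
    "HOL-Library.Disjoint_Sets"
    "HOL-Library.Function_Algebras"
    "HOL-Combinatorics.Permutations"
begin

section \<open>Complex vector spaces of functions\<close>

definition cscale :: "complex \<Rightarrow> ('a \<Rightarrow> complex) \<Rightarrow> ('a \<Rightarrow> complex)" where
  "cscale c f = (\<lambda>x. c * f x)"

global_interpretation cfun: vector_space "cscale :: complex \<Rightarrow> ('a \<Rightarrow> complex) \<Rightarrow> ('a \<Rightarrow> complex)"
  by unfold_locales (auto simp: cscale_def fun_eq_iff algebra_simps)

definition basis_vec :: "'a \<Rightarrow> ('a \<Rightarrow> complex)" where
  "basis_vec b = (\<lambda>x. if x = b then 1 else 0)"

definition lin_ext :: "'a set \<Rightarrow> ('a \<Rightarrow> ('b \<Rightarrow> complex)) \<Rightarrow> ('a \<Rightarrow> complex) \<Rightarrow> ('b \<Rightarrow> complex)" where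
  "lin_ext B f x = (\<Sum>b\<in>B. cscale (x b) (f b))"

text \<open>Linearity of a map that only matters on a subspace \<open>V\<close>.\<close>

definition linear_on :: "('a \<Rightarrow> complex) set \<Rightarrow> (('a \<Rightarrow> complex) \<Rightarrow> ('b \<Rightarrow> complex)) \<Rightarrow> bool" where
  "linear_on V f \<longleftrightarrow>
     (\<forall>x\<in>V. \<forall>y\<in>V. f (x + y) = f x + f y) \<and>
     (\<forall>c. \<forall>x\<in>V. f (cscale c x) = cscale c (f x))"

definition adj_transp :: "nat \<Rightarrow> nat \<Rightarrow> nat" where
  "adj_transp i = Transposition.transpose i (i + 1)"


section \<open>Tableaux and the Specht module\<close>

text \<open>A cell is a pair (row, column), with rows \<open>1, 2\<close> and columns \<open>1, \<dots>, n\<close>. Tableaux are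
  extensional functions on cells, so that equality of tableaux is equality of fillings.\<close>

type_synonym tableau = "nat \<times> nat \<Rightarrow> nat"

definition cells :: "nat \<Rightarrow> (nat \<times> nat) set" where
  "cells n = {1, 2} \<times> {1..n}"

definition tableaux :: "nat \<Rightarrow> tableau set" where
  "tableaux n = {T \<in> extensional (cells n). bij_betw T (cells n) {1..2 * n}}"

definition standard_tableaux :: "nat \<Rightarrow> tableau set" where
  "standard_tableaux n = {T \<in> tableaux n.
     (\<forall>r\<in>{1, 2}. \<forall>c\<in>{1..n}. \<forall>d\<in>{1..n}. c < d \<longrightarrow> T (r, c) < T (r, d)) \<and>
     (\<forall>c\<in>{1..n}. T (1, c) < T (2, c))}"

definition tab_perm :: "nat \<Rightarrow> (nat \<Rightarrow> nat) \<Rightarrow> tableau \<Rightarrow> tableau" where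
  "tab_perm n \<sigma> T = compose (cells n) \<sigma> T"

definition tabloid :: "nat \<Rightarrow> tableau \<Rightarrow> tableau set" where
  "tabloid n T = {T' \<in> tableaux n. \<forall>r\<in>{1, 2}. T' ` ({r} \<times> {1..n}) = T ` ({r} \<times> {1..n})}"

definition col_group :: "nat \<Rightarrow> tableau \<Rightarrow> (nat \<Rightarrow> nat) set" where
  "col_group n T = {\<sigma>. \<sigma> permutes {1..2 * n} \<and>
     (\<forall>c\<in>{1..n}. \<sigma> ` {T (1, c), T (2, c)} = {T (1, c), T (2, c)})}"

definition specht_vec :: "nat \<Rightarrow> tableau \<Rightarrow> (tableau set \<Rightarrow> complex)" where
  "specht_vec n T =
     (\<Sum>\<sigma>\<in>col_group n T. cscale (of_int (sign \<sigma>)) (basis_vec (tabloid n (tab_perm n \<sigma> T))))"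

definition specht_module :: "nat \<Rightarrow> (tableau set \<Rightarrow> complex) set" where
  "specht_module n = cfun.span (specht_vec n ` tableaux n)"

text \<open>The action on the Specht module is the restriction of the permutation action
  \<open>\<sigma> \<cdot> {T} = {\<sigma> \<cdot> T}\<close> on the space spanned by all tabloids; it satisfies \<open>\<sigma> \<cdot> v\<^sub>T = v\<^bsub>\<sigma> \<cdot> T\<^esub>\<close>
  (lemma \<open>specht_act_specht_vec\<close>).\<close>

definition specht_act ::
  "nat \<Rightarrow> (nat \<Rightarrow> nat) \<Rightarrow> (tableau set \<Rightarrow> complex) \<Rightarrow> (tableau set \<Rightarrow> complex)" where
  "specht_act n \<sigma> = lin_ext (tabloid n ` tableaux n) (\<lambda>X. basis_vec (tab_perm n \<sigma> ` X))"


lemma tab_perm_in_tableaux: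
  assumes "T \<in> tableaux n" "\<sigma> permutes {1..2 * n}"
  shows "tab_perm n \<sigma> T \<in> tableaux n"
proof -
  have "bij_betw (\<sigma> \<circ> T) (cells n) {1..2 * n}"
    using assms bij_betw_trans permutes_imp_bij by (fastforce simp: tableaux_def)
  then show ?thesis
    unfolding tableaux_def tab_perm_def
    by (auto simp: compose_def cong: bij_betw_cong)
qed

lemma tab_perm_tab_perm:
  "tab_perm n \<sigma> (tab_perm n \<tau> T) = tab_perm n (\<sigma> \<circ> \<tau>) T"
  by (auto simp: tab_perm_def compose_def fun_eq_iff)

lemma tab_perm_id: "T \<in> tableaux n \<Longrightarrow> tab_perm n id T = T"
  by (auto simp: tab_perm_def compose_def fun_eq_iff tableaux_def extensional_def)

lemma row_tab_perm:
  assumes "r \<in> {1, 2}"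
  shows "tab_perm n \<sigma> T ` ({r} \<times> {1..n}) = \<sigma> ` T ` ({r} \<times> {1..n})"
proof -
  have "{r} \<times> {1..n} \<subseteq> cells n" using assms by (auto simp: cells_def)
  then show ?thesis
    unfolding tab_perm_def compose_def image_image by (intro image_cong) auto
qed

lemma tab_perm_in_tabloid:
  assumes U: "U \<in> tabloid n T" and \<sigma>: "\<sigma> permutes {1..2 * n}"
  shows "tab_perm n \<sigma> U \<in> tabloid n (tab_perm n \<sigma> T)"
  unfolding tabloid_def
proof (intro CollectI conjI ballI)
  show "tab_perm n \<sigma> U \<in> tableaux n"
    using U \<sigma> by (intro tab_perm_in_tableaux) (simp_all add: tabloid_def)
  fix r :: nat assume r: "r \<in> {1, 2}"
  have "U ` ({r} \<times> {1..n}) = T ` ({r} \<times> {1..n})"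
    using U r unfolding tabloid_def by blast
  then show "tab_perm n \<sigma> U ` ({r} \<times> {1..n}) = tab_perm n \<sigma> T ` ({r} \<times> {1..n})"
    by (simp only: row_tab_perm[OF r])
qed

lemma tab_perm_tabloid:
  assumes T: "T \<in> tableaux n" and \<sigma>: "\<sigma> permutes {1..2 * n}"
  shows "tab_perm n \<sigma> ` tabloid n T = tabloid n (tab_perm n \<sigma> T)"
proof
  show "tab_perm n \<sigma> ` tabloid n T \<subseteq> tabloid n (tab_perm n \<sigma> T)"
    using tab_perm_in_tabloid[OF _ \<sigma>] by (rule image_subsetI)
  have inv: "inv \<sigma> permutes {1..2 * n}" using \<sigma> by (rule permutes_inv)
  show "tabloid n (tab_perm n \<sigma> T) \<subseteq> tab_perm n \<sigma> ` tabloid n T"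
  proof
    fix U assume U: "U \<in> tabloid n (tab_perm n \<sigma> T)"
    then have Ut: "U \<in> tableaux n" by (simp add: tabloid_def)
    have "tab_perm n (inv \<sigma>) U \<in> tabloid n T"
      using tab_perm_in_tabloid[OF U inv] T \<sigma>
      by (simp add: tab_perm_tab_perm permutes_inv_o tab_perm_id)
    moreover have "U = tab_perm n \<sigma> (tab_perm n (inv \<sigma>) U)"
      using Ut \<sigma> by (simp add: tab_perm_tab_perm permutes_inv_o tab_perm_id)
    ultimately show "U \<in> tab_perm n \<sigma> ` tabloid n T" by blast
  qed
qed

lemma finite_tableaux: "finite (tableaux n)"
proof (rule finite_subset)
  show "tableaux n \<subseteq> cells n \<rightarrow>\<^sub>E {1..2 * n}"
    by (auto simp: tableaux_def PiE_def bij_betw_def)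
  show "finite (cells n \<rightarrow>\<^sub>E {1..2 * n})"
    by (intro finite_PiE) (auto simp: cells_def)
qed

lemma lin_ext_basis_vec:
  assumes "finite B" "b \<in> B"
  shows "lin_ext B f (basis_vec b) = f b"
proof -
  have "lin_ext B f (basis_vec b) = (\<Sum>x\<in>B. if x = b then f x else 0)"
    unfolding lin_ext_def by (intro sum.cong) (auto simp: basis_vec_def cscale_def fun_eq_iff)
  then show ?thesis using assms by simp
qed

lemma lin_ext_scale: "lin_ext B f (cscale c x) = cscale c (lin_ext B f x)"
  by (simp add: lin_ext_def cfun.scale_sum_right) (simp add: cscale_def)

lemma lin_ext_add: "lin_ext B f (x + y) = lin_ext B f x + lin_ext B f y"
  by (simp add: lin_ext_def sum.distrib cfun.scale_left_distrib)

lemma lin_ext_sum: "lin_ext B f (\<Sum>i\<in>I. g i) = (\<Sum>i\<in>I. lin_ext B f (g i))"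
proof (induction I rule: infinite_finite_induct)
  have "lin_ext B f 0 = 0" by (simp add: lin_ext_def)
  then show "lin_ext B f (sum g I) = (\<Sum>i\<in>I. lin_ext B f (g i))" if "infinite I" for I
    using that by simp
  show "lin_ext B f (sum g {}) = (\<Sum>i\<in>{}. lin_ext B f (g i))"
    using \<open>lin_ext B f 0 = 0\<close> by simp
qed (simp only: sum.insert lin_ext_add not_False_eq_True)

lemma col_group_conj:
  assumes "\<tau> \<in> col_group n T" and \<sigma>: "\<sigma> permutes {1..2 * n}"
  shows "\<sigma> \<circ> \<tau> \<circ> inv \<sigma> \<in> col_group n (tab_perm n \<sigma> T)"
proof -
  have t: "\<tau> permutes {1..2 * n}" using assms by (simp add: col_group_def)
  have "\<sigma> \<circ> \<tau> \<circ> inv \<sigma> permutes {1..2 * n}"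
    using \<sigma> t permutes_compose permutes_inv by metis
  moreover have "(\<sigma> \<circ> \<tau> \<circ> inv \<sigma>) ` {tab_perm n \<sigma> T (1, c), tab_perm n \<sigma> T (2, c)}
      = {tab_perm n \<sigma> T (1, c), tab_perm n \<sigma> T (2, c)}" if c: "c \<in> {1..n}" for c
  proof -
    have eq: "{tab_perm n \<sigma> T (1, c), tab_perm n \<sigma> T (2, c)} = \<sigma> ` {T (1, c), T (2, c)}"
      using c by (auto simp: tab_perm_def compose_def cells_def)
    have "(\<sigma> \<circ> \<tau> \<circ> inv \<sigma>) ` \<sigma> ` {T (1, c), T (2, c)} = \<sigma> ` \<tau> ` {T (1, c), T (2, c)}"
      using permutes_inverses[OF \<sigma>] by (simp add: image_image)
    also have "\<tau> ` {T (1, c), T (2, c)} = {T (1, c), T (2, c)}"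
      using assms c unfolding col_group_def by blast
    finally show ?thesis by (simp only: eq)
  qed
  ultimately show ?thesis by (simp add: col_group_def)
qed

lemma specht_act_specht_vec:
  assumes T: "T \<in> tableaux n" and \<sigma>: "\<sigma> permutes {1..2 * n}"
  shows "specht_act n \<sigma> (specht_vec n T) = specht_vec n (tab_perm n \<sigma> T)"
proof -
  have inv: "inv \<sigma> permutes {1..2 * n}" using \<sigma> by (rule permutes_inv)
  have "specht_act n \<sigma> (specht_vec n T) =
      (\<Sum>\<tau>\<in>col_group n T. cscale (of_int (sign \<tau>)) (basis_vec (tabloid n (tab_perm n (\<sigma> \<circ> \<tau>) T))))"
    unfolding specht_vec_def specht_act_def lin_ext_sum lin_ext_scale
  proof (intro sum.cong refl arg_cong2[of _ _ _ _ cscale])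
    fix \<tau> assume "\<tau> \<in> col_group n T"
    then have t: "tab_perm n \<tau> T \<in> tableaux n"
      using T by (simp add: col_group_def tab_perm_in_tableaux)
    then show "lin_ext (tabloid n ` tableaux n) (\<lambda>X. basis_vec (tab_perm n \<sigma> ` X))
        (basis_vec (tabloid n (tab_perm n \<tau> T))) =
        basis_vec (tabloid n (tab_perm n (\<sigma> \<circ> \<tau>) T))"
      using \<sigma> by (simp add: lin_ext_basis_vec finite_tableaux tab_perm_tabloid tab_perm_tab_perm)
  qed
  also have "\<dots> = specht_vec n (tab_perm n \<sigma> T)"
    unfolding specht_vec_def
  proof (rule sum.reindex_bij_witness[of _ "\<lambda>\<rho>. inv \<sigma> \<circ> \<rho> \<circ> \<sigma>" "\<lambda>\<tau>. \<sigma> \<circ> \<tau> \<circ> inv \<sigma>"])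
    fix \<tau> assume tau: "\<tau> \<in> col_group n T"
    then have t: "\<tau> permutes {1..2 * n}" by (simp add: col_group_def)
    show "inv \<sigma> \<circ> (\<sigma> \<circ> \<tau> \<circ> inv \<sigma>) \<circ> \<sigma> = \<tau>"
      using permutes_inverses[OF \<sigma>] by (simp add: fun_eq_iff)
    show "\<sigma> \<circ> \<tau> \<circ> inv \<sigma> \<in> col_group n (tab_perm n \<sigma> T)"
      using tau \<sigma> by (rule col_group_conj)
    have p: "permutation \<sigma>" "permutation \<tau>" "permutation (inv \<sigma>)"
      using \<sigma> t inv permutation_permutes by blast+
    then have "sign (\<sigma> \<circ> \<tau> \<circ> inv \<sigma>) = sign \<tau>"
      by (simp add: sign_compose permutation_compose sign_inverse sign_idempotent mult.commute
          mult.left_commute)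
    moreover have "\<sigma> \<circ> \<tau> \<circ> inv \<sigma> \<circ> \<sigma> = \<sigma> \<circ> \<tau>"
      using permutes_inverses[OF \<sigma>] by (simp add: fun_eq_iff)
    ultimately show "cscale (of_int (sign (\<sigma> \<circ> \<tau> \<circ> inv \<sigma>)))
        (basis_vec (tabloid n (tab_perm n (\<sigma> \<circ> \<tau> \<circ> inv \<sigma>) (tab_perm n \<sigma> T)))) =
        cscale (of_int (sign \<tau>)) (basis_vec (tabloid n (tab_perm n (\<sigma> \<circ> \<tau>) T)))"
      by (simp add: tab_perm_tab_perm)
  next
    fix \<rho> assume rho: "\<rho> \<in> col_group n (tab_perm n \<sigma> T)"
    show "\<sigma> \<circ> (inv \<sigma> \<circ> \<rho> \<circ> \<sigma>) \<circ> inv \<sigma> = \<rho>"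
      using permutes_inverses[OF \<sigma>] by (simp add: fun_eq_iff)
    show "inv \<sigma> \<circ> \<rho> \<circ> \<sigma> \<in> col_group n T"
      using col_group_conj[OF rho inv] T \<sigma>
      by (simp add: tab_perm_tab_perm permutes_inv_o permutes_inv_inv tab_perm_id)
  qed
  finally show ?thesis .
qed


section \<open>Webs\<close>

text \<open>An arc with endpoints \<open>i\<close> and \<open>j\<close> is the two-element set \<open>{i, j}\<close>.\<close>

type_synonym web = "nat set set"

definition webs :: "nat \<Rightarrow> web set" where
  "webs n = {w. partition_on {1..2 * n} w \<and> (\<forall>a\<in>w. card a = 2) \<and>
     \<not> (\<exists>i j k l. i < k \<and> k < j \<and> j < l \<and> {i, j} \<in> w \<and> {k, l} \<in> w)}"

definition web_module :: "nat \<Rightarrow> (web \<Rightarrow> complex) set" where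
  "web_module n = cfun.span (basis_vec ` webs n)"

definition partner :: "web \<Rightarrow> nat \<Rightarrow> nat" where
  "partner w i = (THE j. {i, j} \<in> w)"

definition web_reconnect :: "nat \<Rightarrow> web \<Rightarrow> web" where
  "web_reconnect i w =
     w - {{i, partner w i}, {i + 1, partner w (i + 1)}}
       \<union> {{i, i + 1}, {partner w i, partner w (i + 1)}}"

definition web_gen_act :: "nat \<Rightarrow> nat \<Rightarrow> (web \<Rightarrow> complex) \<Rightarrow> (web \<Rightarrow> complex)" where
  "web_gen_act n i = lin_ext (webs n)
     (\<lambda>w. if {i, i + 1} \<in> w then - basis_vec w
          else basis_vec w + basis_vec (web_reconnect i w))"

text \<open>The list \<open>[i\<^sub>1, \<dots>, i\<^sub>k]\<close> is a word for \<open>\<sigma>\<close> if \<open>\<sigma> = s\<^bsub>i\<^sub>1\<^esub> \<circ> \<dots> \<circ> s\<^bsub>i\<^sub>k\<^esub>\<close>. The action of \<open>\<sigma>\<close> on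
  webs is computed along some word for \<open>\<sigma>\<close>; the result does not depend on the word, because
  the operators \<open>web_gen_act n i\<close> satisfy the Coxeter relations of the symmetric group.\<close>

definition is_word :: "nat \<Rightarrow> nat list \<Rightarrow> (nat \<Rightarrow> nat) \<Rightarrow> bool" where
  "is_word n is \<sigma> \<longleftrightarrow>
     set is \<subseteq> {1..<2 * n} \<and> foldr (\<lambda>i \<tau>. adj_transp i \<circ> \<tau>) is id = \<sigma>"

definition web_act :: "nat \<Rightarrow> (nat \<Rightarrow> nat) \<Rightarrow> (web \<Rightarrow> complex) \<Rightarrow> (web \<Rightarrow> complex)" where
  "web_act n \<sigma> x = foldr (web_gen_act n) (SOME is. is_word n is \<sigma>) x"


section \<open>The tableau graph and the map \<open>\<phi>\<close>\<close>

definition tab_edge :: "nat \<Rightarrow> tableau \<Rightarrow> nat \<Rightarrow> tableau \<Rightarrow> bool" where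
  "tab_edge n T i T' \<longleftrightarrow>
     T \<in> standard_tableaux n \<and> T' \<in> standard_tableaux n \<and> i \<in> {1..<2 * n} \<and>
     tab_perm n (adj_transp i) T = T' \<and>
     i \<in> T ` ({2} \<times> {1..n}) \<and> i + 1 \<in> T ` ({1} \<times> {1..n})"

text \<open>\<open>tab_path n T \<sigma> T'\<close>: some directed path from \<open>T\<close> to \<open>T'\<close> has label product \<open>\<sigma>\<close>, where the
  label of the first edge acts first.\<close>

inductive tab_path :: "nat \<Rightarrow> tableau \<Rightarrow> (nat \<Rightarrow> nat) \<Rightarrow> tableau \<Rightarrow> bool" for n T where
  refl: "T \<in> standard_tableaux n \<Longrightarrow> tab_path n T id T"
| step: "tab_path n T \<sigma> T' \<Longrightarrow> tab_edge n T' i T'' \<Longrightarrow> tab_path n T (adj_transp i \<circ> \<sigma>) T''"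

definition T0 :: "nat \<Rightarrow> tableau" where
  "T0 n = restrict (\<lambda>(r, c). if r = 1 then 2 * c - 1 else 2 * c) (cells n)"

definition w0 :: "nat \<Rightarrow> web" where
  "w0 n = {{2 * k - 1, 2 * k} | k. k \<in> {1..n}}"

text \<open>\<open>\<phi>\<close> is required to have the prescribed value for every directed path, so that the existence of
  such a \<open>\<phi>\<close> includes independence of the chosen path.\<close>

definition is_phi ::
  "nat \<Rightarrow> ((tableau set \<Rightarrow> complex) \<Rightarrow> (web \<Rightarrow> complex)) \<Rightarrow> bool" where
  "is_phi n \<phi> \<longleftrightarrow>
     linear_on (specht_module n) \<phi> \<and>
     \<phi> ` specht_module n \<subseteq> web_module n \<and>
     (\<forall>T\<in>standard_tableaux n. \<forall>\<sigma>. tab_path n (T0 n) \<sigma> T \<longrightarrow>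
        \<phi> (specht_vec n T) = web_act n \<sigma> (basis_vec (w0 n)))"

definition equivariant ::
  "nat \<Rightarrow> ((tableau set \<Rightarrow> complex) \<Rightarrow> (web \<Rightarrow> complex)) \<Rightarrow> bool" where
  "equivariant n \<phi> \<longleftrightarrow>
     (\<forall>\<sigma>. \<sigma> permutes {1..2 * n} \<longrightarrow>
        (\<forall>x\<in>specht_module n. \<phi> (specht_act n \<sigma> x) = web_act n \<sigma> (\<phi> x)))"

definition equivariant_iso ::
  "nat \<Rightarrow> ((tableau set \<Rightarrow> complex) \<Rightarrow> (web \<Rightarrow> complex)) \<Rightarrow> bool" where
  "equivariant_iso n \<psi> \<longleftrightarrow>
     linear_on (specht_module n) \<psi> \<and>
     bij_betw \<psi> (specht_module n) (web_module n) \<and>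
     equivariant n \<psi>"

end

theory Submission
  imports Defs "HOL-Library.Infinite_Set"
begin

text \<open>
  Both modules are realised inside the functions on tabloids, and \<open>\<phi>\<close> turns out to be the inverse of
  one explicit map.  A tabloid is the same as the set \<open>S\<close> of entries of its first row.  Write
  \<open>x\<^sub>m\<close> for the indicator of \<open>m \<in> S\<close>, as a function of \<open>S\<close>.  Expanding a product
  over the columns gives \<open>v\<^sub>T = \<Prod>\<^sub>c (x\<^bsub>T(1,c)\<^esub> - x\<^bsub>T(2,c)\<^esub>)\<close>
  (\<open>specht_vec_apply\<close>), so up to sign \<open>v\<^sub>T\<close> depends only on the perfect matching formed
  by the columns of \<open>T\<close>.  To a web \<open>w\<close> one attaches in the same way the product of
  \<open>x\<^sub>i - x\<^sub>j\<close> over its arcs \<open>(i, j)\<close>, \<open>i < j\<close>; this is the linear map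
  \<open>web_embedding\<close>, and it sends \<open>w\<^sub>0\<close> to the Specht vector of \<open>T\<^sub>0\<close>.

  The engine is the identity
  \<open>(x\<^sub>a - x\<^sub>c) (x\<^sub>b - x\<^sub>d) = (x\<^sub>a - x\<^sub>b) (x\<^sub>c - x\<^sub>d) + (x\<^sub>a - x\<^sub>d) (x\<^sub>b - x\<^sub>c)\<close>
  (\<open>matching_vec_pluecker\<close>).  Read as a rule that removes crossings, it shows that the webs span
  the Specht module; read as a rule that removes nestings, it shows that the standard tableaux do.
  Read as the effect of exchanging \<open>i\<close> and \<open>i + 1\<close>, it says that the map commutes with
  the generators (\<open>web_embedding_gen_act\<close>): this is where the rule
  \<open>s\<^sub>i \<cdot> w = w + w'\<close> comes from.  The map is injective, since the coefficient matrix of the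
  webs is triangular with respect to the sums of left endpoints, and a web is determined by its left
  endpoints (\<open>web_embedding_eq_0\<close>).

  Injectivity replaces a check of the Coxeter relations: along any word for \<open>\<sigma>\<close>, the operators
  on webs are carried to the action of \<open>\<sigma>\<close> on the Specht module, so the result is the same for
  all words.  A path from \<open>T\<^sub>0\<close> to \<open>T\<close> with product \<open>\<sigma>\<close> therefore sends
  \<open>w\<^sub>0\<close> to a vector with image \<open>v\<^sub>T\<close>, whichever path is taken.  As every
  standard tableau is reached by a path (\<open>exists_tab_path\<close>), a linear map satisfies the defining
  property of \<open>\<phi>\<close> iff it is the inverse of \<open>web_embedding\<close>
  (\<open>is_phi_iff_inverse\<close>), and such an inverse is an equivariant isomorphism.

  For uniqueness, an equivariant \<open>\<psi>\<close> is determined by its value at the Specht vector of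
  \<open>T\<^sub>0\<close>.  That vector is negated by the exchange of \<open>2 k - 1\<close> and \<open>2 k\<close>
  for every \<open>k \<le> n\<close>, and in the web module only the multiples of \<open>w\<^sub>0\<close> have this
  property (\<open>antisymmetric_web_vector\<close>).
\<close>

section \<open>Coefficients of Specht vectors\<close>

lemma tableau_entry:
  assumes "T \<in> tableaux n" "r \<in> {1, 2}" "c \<in> {1..n}"
  shows "T (r, c) \<in> {1..2 * n}"
  using assms by (auto simp: tableaux_def cells_def bij_betw_def)

lemma tableau_entry_eq_iff:
  assumes "T \<in> tableaux n" "r \<in> {1, 2}" "c \<in> {1..n}" "r' \<in> {1, 2}" "c' \<in> {1..n}"
  shows "T (r, c) = T (r', c') \<longleftrightarrow> r = r' \<and> c = c'"
proof -
  have "inj_on T (cells n)" using assms(1) by (simp add: tableaux_def bij_betw_def)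
  moreover have "(r, c) \<in> cells n" "(r', c') \<in> cells n" using assms by (simp_all add: cells_def)
  ultimately show ?thesis by (simp add: inj_on_eq_iff)
qed

lemma tableau_entry_cases:
  assumes "T \<in> tableaux n" "x \<in> {1..2 * n}"
  obtains c where "c \<in> {1..n}" "x = T (1, c)" | c where "c \<in> {1..n}" "x = T (2, c)"
proof -
  have "x \<in> T ` cells n" using assms by (simp add: tableaux_def bij_betw_def)
  then show thesis using that by (auto simp: cells_def)
qed

lemma tab_perm_cell:
  "r \<in> {1, 2} \<Longrightarrow> c \<in> {1..n} \<Longrightarrow> tab_perm n \<sigma> T (r, c) = \<sigma> (T (r, c))"
  by (auto simp: tab_perm_def compose_def cells_def)

lemma second_row_eq_Diff:
  assumes T: "T \<in> tableaux n"
  shows "T ` ({2} \<times> {1..n}) = {1..2 * n} - T ` ({1} \<times> {1..n})"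
proof -
  have b: "inj_on T (cells n)" "T ` cells n = {1..2 * n}" using T by (auto simp: tableaux_def bij_betw_def)
  have "{2} \<times> {1..n} = cells n - {1} \<times> {1..n}" by (auto simp: cells_def)
  moreover have "{1} \<times> {1..n} \<subseteq> cells n" by (auto simp: cells_def)
  ultimately show ?thesis using b by (simp add: inj_on_image_set_diff[of T "cells n"])
qed

text \<open>The members of a tabloid share their first row, so the union over all of them is that row.\<close>

definition first_row :: "nat \<Rightarrow> tableau set \<Rightarrow> nat set" where
  "first_row n X = (\<Union>U\<in>X. U ` ({1} \<times> {1..n}))"

lemma first_row_tabloid:
  assumes T: "T \<in> tableaux n"
  shows "first_row n (tabloid n T) = T ` ({1} \<times> {1..n})"
proof -
  have "T \<in> tabloid n T" using T by (simp add: tabloid_def)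
  moreover have "U ` ({1} \<times> {1..n}) = T ` ({1} \<times> {1..n})" if "U \<in> tabloid n T" for U
    using that by (simp add: tabloid_def)
  ultimately show ?thesis unfolding first_row_def by blast
qed

lemma tabloid_eq_iff:
  assumes "T \<in> tableaux n" "U \<in> tableaux n"
  shows "tabloid n T = tabloid n U \<longleftrightarrow> T ` ({1} \<times> {1..n}) = U ` ({1} \<times> {1..n})"
proof
  assume "tabloid n T = tabloid n U"
  then show "T ` ({1} \<times> {1..n}) = U ` ({1} \<times> {1..n})"
    using first_row_tabloid assms by metis
next
  assume r: "T ` ({1} \<times> {1..n}) = U ` ({1} \<times> {1..n})"
  moreover have "T ` ({2} \<times> {1..n}) = U ` ({2} \<times> {1..n})"
    using r by (simp only: second_row_eq_Diff assms)
  ultimately show "tabloid n T = tabloid n U" unfolding tabloid_def by auto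
qed

text \<open>The column group is elementary abelian: an element is determined by the columns that it
  flips, and every set of columns occurs.  Reindexing the sum over the column group by sets of
  columns is what turns a Specht vector into the expansion of a product.\<close>

definition flipped_columns :: "nat \<Rightarrow> tableau \<Rightarrow> (nat \<Rightarrow> nat) \<Rightarrow> nat set" where
  "flipped_columns n T \<sigma> = {c \<in> {1..n}. \<sigma> (T (1, c)) = T (2, c)}"

lemma col_group_apply:
  assumes T: "T \<in> tableaux n" and s: "\<sigma> \<in> col_group n T" and c: "c \<in> {1..n}"
  shows "\<sigma> (T (1, c)) = (if c \<in> flipped_columns n T \<sigma> then T (2, c) else T (1, c))"
    and "\<sigma> (T (2, c)) = (if c \<in> flipped_columns n T \<sigma> then T (1, c) else T (2, c))"
proof -
  have im: "\<sigma> ` {T (1, c), T (2, c)} = {T (1, c), T (2, c)}"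
    and p: "\<sigma> permutes {1..2 * n}" using s c unfolding col_group_def by blast+
  have "\<sigma> (T (1, c)) \<noteq> \<sigma> (T (2, c))"
    using tableau_entry_eq_iff[OF T] c permutes_inj[OF p] by (simp add: inj_eq)
  then show "\<sigma> (T (1, c)) = (if c \<in> flipped_columns n T \<sigma> then T (2, c) else T (1, c))"
    and "\<sigma> (T (2, c)) = (if c \<in> flipped_columns n T \<sigma> then T (1, c) else T (2, c))"
    using im c unfolding flipped_columns_def by (auto simp: doubleton_eq_iff)
qed

lemma inj_on_flipped_columns:
  assumes T: "T \<in> tableaux n"
  shows "inj_on (flipped_columns n T) (col_group n T)"
proof (rule inj_onI)
  fix \<sigma> \<tau> assume s: "\<sigma> \<in> col_group n T" and t: "\<tau> \<in> col_group n T"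
    and eq: "flipped_columns n T \<sigma> = flipped_columns n T \<tau>"
  show "\<sigma> = \<tau>"
  proof
    fix x show "\<sigma> x = \<tau> x"
    proof (cases "x \<in> {1..2 * n}")
      case True
      then show ?thesis
        using col_group_apply[OF T s] col_group_apply[OF T t] eq
        by (elim tableau_entry_cases[OF T]) simp_all
    next
      case False
      moreover have "\<sigma> permutes {1..2 * n}" "\<tau> permutes {1..2 * n}"
        using s t by (simp_all add: col_group_def)
      ultimately show ?thesis using permutes_not_in by metis
    qed
  qed
qed

text \<open>Every set of columns is flipped by a product of transpositions, one for each of its columns; hence the
  sign.\<close>

lemma exists_column_flip:
  assumes T: "T \<in> tableaux n" and "finite D" "D \<subseteq> {1..n}"
  shows "\<exists>\<sigma>\<in>col_group n T. sign \<sigma> = (-1) ^ card D \<and> flipped_columns n T \<sigma> = D"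
  using assms(2,3)
proof (induction D rule: finite_induct)
  case empty
  have "flipped_columns n T id = {}"
    using tableau_entry_eq_iff[OF T] by (auto simp: flipped_columns_def)
  then show ?case unfolding id_def by (intro bexI[of _ "\<lambda>x. x"]) (auto simp: col_group_def permutes_id[unfolded id_def])
next
  case (insert d D)
  then obtain \<sigma> where s: "\<sigma> \<in> col_group n T" "sign \<sigma> = (-1) ^ card D" "flipped_columns n T \<sigma> = D"
    by auto
  define t where "t = Transposition.transpose (T (1, d)) (T (2, d))"
  have d: "d \<in> {1..n}" using insert by simp
  have p: "\<sigma> permutes {1..2 * n}" using s by (simp add: col_group_def)
  have tp: "t permutes {1..2 * n}"
    unfolding t_def using tableau_entry[OF T _ d] by (intro permutes_swap_id) auto
  have tv: "t (T (1, c)) = (if c = d then T (2, c) else T (1, c))"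
    "t (T (2, c)) = (if c = d then T (1, c) else T (2, c))" if "c \<in> {1..n}" for c
    using that d tableau_entry_eq_iff[OF T] by (auto simp: t_def Transposition.transpose_def)
  have v: "(t \<circ> \<sigma>) (T (1, c)) = (if c \<in> insert d D then T (2, c) else T (1, c))"
    "(t \<circ> \<sigma>) (T (2, c)) = (if c \<in> insert d D then T (1, c) else T (2, c))" if "c \<in> {1..n}" for c
    using col_group_apply[OF T s(1) that] s(3) tv[OF that] insert.hyps(2) by auto
  have "t \<circ> \<sigma> permutes {1..2 * n}" using p tp by (rule permutes_compose)
  moreover have "(t \<circ> \<sigma>) ` {T (1, c), T (2, c)} = {T (1, c), T (2, c)}" if "c \<in> {1..n}" for c
    using v[OF that] by auto
  ultimately have "t \<circ> \<sigma> \<in> col_group n T" by (simp add: col_group_def)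
  moreover have "flipped_columns n T (t \<circ> \<sigma>) = insert d D"
  proof -
    have "T (1, c) \<noteq> T (2, c)" if "c \<in> {1..n}" for c
      using tableau_entry_eq_iff[OF T] that by simp
    then show ?thesis using v insert.prems unfolding flipped_columns_def by (auto split: if_splits)
  qed
  moreover have "sign (t \<circ> \<sigma>) = (-1) ^ card (insert d D)"
  proof -
    have "permutation t" "permutation \<sigma>" using p tp permutation_permutes by blast+
    moreover have "T (1, d) \<noteq> T (2, d)" using tableau_entry_eq_iff[OF T] d by simp
    then have "sign t = -1" by (simp add: t_def sign_swap_id)
    ultimately show ?thesis using insert.hyps s(2) by (simp add: sign_compose)
  qed
  ultimately show ?case by blast
qed

lemma sign_col_group:
  assumes T: "T \<in> tableaux n" and s: "\<sigma> \<in> col_group n T"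
  shows "sign \<sigma> = (-1) ^ card (flipped_columns n T \<sigma>)"
proof -
  have "flipped_columns n T \<sigma> \<subseteq> {1..n}" by (auto simp: flipped_columns_def)
  moreover have "finite (flipped_columns n T \<sigma>)" by (simp add: flipped_columns_def)
  ultimately obtain \<tau> where "\<tau> \<in> col_group n T" "sign \<tau> = (-1) ^ card (flipped_columns n T \<sigma>)"
    "flipped_columns n T \<tau> = flipped_columns n T \<sigma>"
    using exists_column_flip[OF T] by meson
  then show ?thesis using inj_onD[OF inj_on_flipped_columns[OF T]] s by metis
qed

lemma bij_betw_flipped_columns:
  assumes T: "T \<in> tableaux n"
  shows "bij_betw (flipped_columns n T) (col_group n T) (Pow {1..n})"
proof -
  have "flipped_columns n T ` col_group n T \<subseteq> Pow {1..n}" by (auto simp: flipped_columns_def)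
  moreover have "Pow {1..n} \<subseteq> flipped_columns n T ` col_group n T"
  proof
    fix D assume "D \<in> Pow {1..n}"
    then have "finite D" "D \<subseteq> {1..n}" by (auto intro: finite_subset)
    then show "D \<in> flipped_columns n T ` col_group n T" using exists_column_flip[OF T] by blast
  qed
  ultimately show ?thesis using inj_on_flipped_columns[OF T] by (simp add: bij_betw_def)
qed

lemma prod_of_bool: "finite A \<Longrightarrow> (\<Prod>x\<in>A. of_bool (P x) :: complex) = of_bool (\<forall>x\<in>A. P x)"
  by (induction A rule: finite_induct) auto

lemma sum_apply: "(\<Sum>i\<in>I. f i) x = (\<Sum>i\<in>I. (f i x :: complex))"
  by (induction I rule: infinite_finite_induct) auto

text \<open>The summand of a Specht vector for the set \<open>D\<close> of flipped columns is the tabloid whose first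
  row picks the lower entry in the columns of \<open>D\<close> and the upper entry elsewhere.  These are the terms
  of the expanded product below: since a first row has exactly \<open>n\<close> elements, it contains the
  \<open>n\<close> picked entries iff it equals the set of them.\<close>

lemma specht_vec_apply:
  assumes T: "T \<in> tableaux n"
  shows "specht_vec n T X = (if X \<in> tabloid n ` tableaux n
    then \<Prod>c\<in>{1..n}. of_bool (T (1, c) \<in> first_row n X) - of_bool (T (2, c) \<in> first_row n X) else 0)"
proof -
  define pick where "pick D c = (if c \<in> D then T (2, c) else T (1, c))" for D c
  have cf: "finite (col_group n T)"
    using bij_betw_finite[OF bij_betw_flipped_columns[OF T]] by simp
  have eval: "specht_vec n T X
     = (\<Sum>\<sigma>\<in>col_group n T. of_int (sign \<sigma>) * of_bool (X = tabloid n (tab_perm n \<sigma> T)))"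
    unfolding specht_vec_def sum_apply
    by (intro sum.cong) (auto simp: cscale_def basis_vec_def)
  have tp: "tab_perm n \<sigma> T \<in> tableaux n" if "\<sigma> \<in> col_group n T" for \<sigma>
    using that T by (simp add: tab_perm_in_tableaux col_group_def)
  show ?thesis
  proof (cases "X \<in> tabloid n ` tableaux n")
    case False
    then have "X \<noteq> tabloid n (tab_perm n \<sigma> T)" if "\<sigma> \<in> col_group n T" for \<sigma>
      using tp[OF that] by blast
    then show ?thesis using False unfolding eval by simp
  next
    case True
    then obtain U where U: "U \<in> tableaux n" "X = tabloid n U" by blast
    define S where "S = first_row n X"
    have S: "S = U ` ({1} \<times> {1..n})" using U by (simp add: S_def first_row_tabloid)
    have injr: "inj_on U ({1} \<times> {1..n})"
      using tableau_entry_eq_iff[OF U(1)] by (auto simp: inj_on_def)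
    have cS: "card S = n" "finite S" unfolding S using injr by (simp_all add: card_image card_cartesian_product)
    have pickS: "X = tabloid n (tab_perm n \<sigma> T) \<longleftrightarrow> (\<forall>c\<in>{1..n}. pick (flipped_columns n T \<sigma>) c \<in> S)"
      if s: "\<sigma> \<in> col_group n T" for \<sigma>
    proof -
      let ?p = "pick (flipped_columns n T \<sigma>)"
      have "tab_perm n \<sigma> T ` ({1} \<times> {1..n}) = (\<lambda>c. tab_perm n \<sigma> T (1, c)) ` {1..n}" by auto
      also have "\<dots> = ?p ` {1..n}"
        using col_group_apply[OF T s] by (intro image_cong) (simp_all add: tab_perm_cell pick_def)
      finally have im: "tab_perm n \<sigma> T ` ({1} \<times> {1..n}) = ?p ` {1..n}" .
      have "inj_on ?p {1..n}"
        using tableau_entry_eq_iff[OF T] by (auto simp: inj_on_def pick_def)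
      then have "card (?p ` {1..n}) = n" by (simp add: card_image)
      then have "S = ?p ` {1..n} \<longleftrightarrow> ?p ` {1..n} \<subseteq> S"
        using cS card_subset_eq[of S "?p ` {1..n}"] by auto
      then show ?thesis
        unfolding U(2) tabloid_eq_iff[OF U(1) tp[OF s]] im S[symmetric] by auto
    qed
    have "specht_vec n T X = (\<Sum>\<sigma>\<in>col_group n T. (-1) ^ card (flipped_columns n T \<sigma>) *
        of_bool (\<forall>c\<in>{1..n}. pick (flipped_columns n T \<sigma>) c \<in> S))"
      unfolding eval
    proof (rule sum.cong[OF HOL.refl])
      fix \<sigma> assume s: "\<sigma> \<in> col_group n T"
      show "of_int (sign \<sigma>) * of_bool (X = tabloid n (tab_perm n \<sigma> T)) =
        ((-1) ^ card (flipped_columns n T \<sigma>) *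
        of_bool (\<forall>c\<in>{1..n}. pick (flipped_columns n T \<sigma>) c \<in> S) :: complex)"
        unfolding pickS[OF s] sign_col_group[OF T s] by simp
    qed
    also have "\<dots> = (\<Sum>D\<in>Pow {1..n}. (-1) ^ card D * of_bool (\<forall>c\<in>{1..n}. pick D c \<in> S))"
      using bij_betw_flipped_columns[OF T] by (rule sum.reindex_bij_betw)
    also have "\<dots> = (\<Sum>D\<in>Pow {1..n}. (-1) ^ card D *
        (\<Prod>c\<in>D. of_bool (T (2, c) \<in> S)) * (\<Prod>c\<in>{1..n} - D. of_bool (T (1, c) \<in> S)))"
    proof (intro sum.cong HOL.refl)
      fix D assume "D \<in> Pow {1..n}"
      then have D: "D \<subseteq> {1..n}" "finite D" by (auto intro: finite_subset)
      have "(\<forall>c\<in>{1..n}. pick D c \<in> S) \<longleftrightarrow>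
        (\<forall>c\<in>D. T (2, c) \<in> S) \<and> (\<forall>c\<in>{1..n} - D. T (1, c) \<in> S)"
        using D(1) unfolding pick_def by auto
      then show "(-1) ^ card D * of_bool (\<forall>c\<in>{1..n}. pick D c \<in> S) = (-1) ^ card D *
        (\<Prod>c\<in>D. of_bool (T (2, c) \<in> S)) * (\<Prod>c\<in>{1..n} - D. of_bool (T (1, c) \<in> S) :: complex)"
        using D(2) by (simp add: prod_of_bool)
    qed
    also have "\<dots> = (\<Prod>c\<in>{1..n}. of_bool (T (1, c) \<in> S) - of_bool (T (2, c) \<in> S))"
      by (rule prod_diff_conv_sum[symmetric]) simp
    finally show ?thesis using True by (simp add: S_def)
  qed
qed

section \<open>Perfect matchings\<close>

definition matchings :: "nat \<Rightarrow> web set" where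
  "matchings n = {M. partition_on {1..2 * n} M \<and> (\<forall>a\<in>M. card a = 2)}"

lemma matching_arcE:
  assumes "M \<in> matchings n" "a \<in> M"
  obtains i j where "a = {i, j}" "i < j" "i \<in> {1..2 * n}" "j \<in> {1..2 * n}"
proof -
  have "card a = 2" "a \<subseteq> {1..2 * n}"
    using assms partition_onD1 by (fastforce simp: matchings_def)+
  then obtain x y where "a = {x, y}" "x \<noteq> y" "x \<in> {1..2 * n}" "y \<in> {1..2 * n}"
    by (auto simp: card_2_iff)
  then show thesis using that[of x y] that[of y x] by (cases "x < y") (auto simp: insert_commute)
qed

lemma matching_arcD:
  assumes "M \<in> matchings n" "{x, y} \<in> M"
  shows "x \<noteq> y" "x \<in> {1..2 * n}" "y \<in> {1..2 * n}"
  using assms by (auto elim!: matching_arcE[of M n "{x, y}"] simp: doubleton_eq_iff)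

lemma matching_disjoint:
  assumes "M \<in> matchings n" "a \<in> M" "b \<in> M" "x \<in> a" "x \<in> b"
  shows "a = b"
proof -
  have "disjoint M" using assms by (auto simp: matchings_def partition_onD2)
  then show ?thesis using assms by (auto simp: disjoint_def)
qed

lemma matching_arc_unique:
  assumes "M \<in> matchings n" "{x, y} \<in> M" "{x, z} \<in> M"
  shows "y = z"
  using matching_disjoint[OF assms, of x] by (auto simp: doubleton_eq_iff)

lemma matching_arc_exists:
  assumes M: "M \<in> matchings n" and "x \<in> {1..2 * n}"
  obtains y where "{x, y} \<in> M"
proof -
  have "\<Union>M = {1..2 * n}" using M by (auto simp: matchings_def dest: partition_onD1)
  then have "x \<in> \<Union>M" using assms(2) by (simp only:)
  then obtain a where a: "a \<in> M" "x \<in> a" by blast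
  then obtain i j where "a = {i, j}" using matching_arcE[OF M] by metis
  then show thesis using a that[of i] that[of j] by (auto simp: insert_commute)
qed

lemma partner_eq:
  assumes "M \<in> matchings n" "{x, y} \<in> M"
  shows "partner M x = y"
  unfolding partner_def using assms by (auto intro: matching_arc_unique)

lemma finite_matching: "M \<in> matchings n \<Longrightarrow> finite M"
  by (rule finite_elements[of "{1..2 * n}"]) (auto simp: matchings_def)

lemma card_matching:
  assumes M: "M \<in> matchings n"
  shows "card M = n"
proof -
  have U: "\<Union>M = {1..2 * n}" using M by (auto simp: matchings_def dest: partition_onD1)
  have "2 * card M = card (\<Union>M)"
    using M finite_matching[OF M] U matching_disjoint[OF M]
    by (intro card_partition) (auto simp: matchings_def)
  then show ?thesis by (simp add: U)
qed

lemma matching_subset_eq: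
  assumes "M \<in> matchings n" "N \<in> matchings n" "M \<subseteq> N"
  shows "M = N"
  using assms by (simp add: card_matching card_subset_eq finite_matching)

lemma finite_matchings: "finite (matchings n)"
proof (rule finite_subset)
  show "matchings n \<subseteq> Pow (Pow {1..2 * n})"
    by (fastforce simp: matchings_def dest: partition_onD1)
qed simp

lemma matching_two_arcs:
  assumes M: "M \<in> matchings n" and ab: "{a, b} \<in> M" and cd: "{c, d} \<in> M" and ne: "{a, b} \<noteq> {c, d}"
  obtains R where "M = insert {a, b} (insert {c, d} R)" "finite R" "\<Union>R \<inter> {a, b, c, d} = {}"
    "distinct [a, b, c, d]"
proof
  let ?R = "M - {{a, b}, {c, d}}"
  show "M = insert {a, b} (insert {c, d} ?R)" using ab cd by auto
  show "finite ?R" using finite_matching[OF M] by simp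
  show "\<Union>?R \<inter> {a, b, c, d} = {}"
    using matching_disjoint[OF M _ ab] matching_disjoint[OF M _ cd] by fastforce
  have "{a, b} \<inter> {c, d} = {}" using matching_disjoint[OF M ab cd] ne by blast
  then show "distinct [a, b, c, d]" using matching_arcD[OF M ab] matching_arcD[OF M cd] by auto
qed

text \<open>Uncrossing two arcs, unnesting them, and reconnecting them at adjacent points are all instances of
  this move.\<close>

lemma matching_replace_arcs:
  assumes M: "insert {a, b} (insert {c, d} R) \<in> matchings n"
    and R: "\<Union>R \<inter> {a, b, c, d} = {}"
    and eq: "{p, q, r, s} = {a, b, c, d}" and dist: "distinct [p, q, r, s]"
  shows "insert {p, q} (insert {r, s} R) \<in> matchings n"
proof -
  let ?M = "insert {a, b} (insert {c, d} R)" and ?N = "insert {p, q} (insert {r, s} R)"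
  have U: "\<Union>?M = {1..2 * n}" using M by (auto simp: matchings_def dest: partition_onD1)
  have c2: "card e = 2" if "e \<in> R" for e using M that by (auto simp: matchings_def)
  have "\<Union>?N = {p, q, r, s} \<union> \<Union>R" by auto
  also have "\<dots> = \<Union>?M" unfolding eq by auto
  finally have 1: "\<Union>?N = {1..2 * n}" using U by (simp only:)
  have "disjoint R" using M unfolding matchings_def partition_on_def disjoint_def by blast
  moreover have "e \<inter> {p, q, r, s} = {}" if "e \<in> R" for e using R that unfolding eq by blast
  moreover have "{p, q} \<inter> {r, s} = {}" using dist by auto
  ultimately have 2: "disjoint ?N" unfolding disjoint_def by blast
  have 3: "\<forall>e\<in>?N. card e = 2" using dist c2 by auto
  then have "{} \<notin> ?N" by fastforce
  then have "partition_on {1..2 * n} ?N" using 1 2 by (simp add: partition_on_def)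
  then show ?thesis using 3 by (simp add: matchings_def)
qed

subsection \<open>Vectors of matchings\<close>

text \<open>For an arc with endpoints \<open>i < j\<close> this is \<open>x\<^sub>i - x\<^sub>j\<close>, where \<open>x\<^sub>m\<close> is the
  indicator of \<open>m \<in> S\<close>.\<close>

definition bracket :: "nat set \<Rightarrow> nat set \<Rightarrow> complex" where
  "bracket S a = of_bool (Min a \<in> S) - of_bool (Max a \<in> S)"

lemma bracket_arc:
  "i < j \<Longrightarrow> bracket S {i, j} = of_bool (i \<in> S) - of_bool (j \<in> S)"
  by (simp add: bracket_def min_def max_def)

definition matching_vec :: "nat \<Rightarrow> web \<Rightarrow> tableau set \<Rightarrow> complex" where
  "matching_vec n M X =
     (if X \<in> tabloid n ` tableaux n then \<Prod>a\<in>M. bracket (first_row n X) a else 0)"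

lemma prod_two_arcs:
  fixes f :: "nat set \<Rightarrow> 'a :: comm_monoid_mult"
  assumes "finite R" "\<Union>R \<inter> {a, b, c, d} = {}" "distinct [a, b, c, d]"
  shows "prod f (insert {a, b} (insert {c, d} R)) = f {a, b} * f {c, d} * prod f R"
proof -
  have "{c, d} \<notin> R" using assms(2) by blast
  moreover have "{a, b} \<notin> insert {c, d} R" using assms(2,3) by (auto simp: doubleton_eq_iff)
  ultimately show ?thesis using assms(1) by (simp add: mult.assoc)
qed

lemma sum_two_arcs:
  fixes f :: "nat set \<Rightarrow> 'a :: comm_monoid_add"
  assumes "finite R" "\<Union>R \<inter> {a, b, c, d} = {}" "distinct [a, b, c, d]"
  shows "sum f (insert {a, b} (insert {c, d} R)) = f {a, b} + f {c, d} + sum f R"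
proof -
  have "{c, d} \<notin> R" using assms(2) by blast
  moreover have "{a, b} \<notin> insert {c, d} R" using assms(2,3) by (auto simp: doubleton_eq_iff)
  ultimately show ?thesis using assms(1) by (simp add: add.assoc)
qed

text \<open>The three-term Pluecker relation, for four points on a line: it is a polynomial identity in
  \<open>x\<^sub>a, x\<^sub>b, x\<^sub>c, x\<^sub>d\<close>, and the remaining arcs contribute a common factor.\<close>

lemma matching_vec_pluecker:
  assumes "finite R" "\<Union>R \<inter> {a, b, c, d} = {}" "a < b" "b < c" "c < d"
  shows "matching_vec n (insert {a, c} (insert {b, d} R)) =
    matching_vec n (insert {a, b} (insert {c, d} R)) + matching_vec n (insert {a, d} (insert {b, c} R))"
proof
  fix X
  have "\<Union>R \<inter> {a, c, b, d} = {}" "\<Union>R \<inter> {a, d, b, c} = {}" using assms(2) by auto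
  then show "matching_vec n (insert {a, c} (insert {b, d} R)) X =
    (matching_vec n (insert {a, b} (insert {c, d} R)) + matching_vec n (insert {a, d} (insert {b, c} R))) X"
    using assms
    by (simp add: matching_vec_def prod_two_arcs bracket_arc algebra_simps)
qed

lemma inj_on_Min_matching:
  assumes M: "M \<in> matchings n"
  shows "inj_on Min M"
proof (rule inj_onI)
  fix a b assume "a \<in> M" "b \<in> M" "Min a = Min b"
  moreover have "finite e" "e \<noteq> {}" if "e \<in> M" for e using matching_arcE[OF M that] by auto
  ultimately show "a = b" using matching_disjoint[OF M] Min_in by metis
qed

text \<open>The tableau writes each arc as a column, with the left endpoint on top.  The order of the columns is
  free.\<close>

definition lists_arcs :: "nat \<Rightarrow> tableau \<Rightarrow> web \<Rightarrow> bool" where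
  "lists_arcs n T M \<longleftrightarrow> T \<in> tableaux n \<and> bij_betw (\<lambda>c. {T (1, c), T (2, c)}) {1..n} M \<and>
     (\<forall>c\<in>{1..n}. T (1, c) < T (2, c))"

text \<open>The additional monotonicity comes from listing the arcs by increasing left endpoint.  It is what makes
  the tableau of a nonnesting matching standard.\<close>

lemma exists_lists_arcs:
  assumes M: "M \<in> matchings n"
  shows "\<exists>T. lists_arcs n T M \<and> (\<forall>c\<in>{1..n}. \<forall>d\<in>{1..n}. c < d \<longrightarrow> T (1, c) < T (1, d))"
proof -
  have injMin: "inj_on Min M" using M by (rule inj_on_Min_matching)
  have "finite (Min ` M)" "card (Min ` M) = n"
    using injMin by (simp_all add: finite_matching[OF M] card_image card_matching[OF M])
  then obtain h where h: "bij_betw h {..<n} (Min ` M)" and mono: "strict_mono_on {..<n} h"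
    using ex_bij_betw_strict_mono_card by metis
  define f where "f c = h (c - 1)" for c
  have shift: "bij_betw (\<lambda>c. c - 1) {1..n} {..<n}"
    by (rule bij_betwI[of _ _ _ Suc]) auto
  have f: "bij_betw f {1..n} (Min ` M)"
    using bij_betw_trans[OF shift h] unfolding f_def comp_def .
  define g where "g c = partner M (f c)" for c
  have arc: "{f c, g c} \<in> M" "f c < g c" if "c \<in> {1..n}" for c
  proof -
    have "f c \<in> Min ` M" using bij_betwE[OF f] that by blast
    then obtain a where a: "a \<in> M" "f c = Min a" by blast
    obtain i j where ij: "a = {i, j}" "i < j" using matching_arcE[OF M a(1)] by metis
    then have fi: "f c = i" using a by (simp add: min_def)
    have "partner M i = j" using a(1) unfolding ij(1) by (rule partner_eq[OF M])
    then have "g c = j" by (simp add: g_def fi)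
    then show "{f c, g c} \<in> M" "f c < g c" using ij a(1) fi by simp_all
  qed
  have Min_arc: "Min {f c, g c} = f c" if "c \<in> {1..n}" for c using arc[OF that] by (simp add: min_def)
  have bij: "bij_betw (\<lambda>c. {f c, g c}) {1..n} M"
    unfolding bij_betw_def
  proof
    show "inj_on (\<lambda>c. {f c, g c}) {1..n}"
      using Min_arc bij_betw_imp_inj_on[OF f] unfolding inj_on_def by metis
    show "(\<lambda>c. {f c, g c}) ` {1..n} = M"
    proof (intro subset_antisym subsetI)
      fix a assume "a \<in> M"
      then obtain c where "c \<in> {1..n}" "Min a = f c" using bij_betw_imp_surj_on[OF f] by blast
      then have "{f c, g c} = a"
        using inj_onD[OF injMin _ arc(1)[of c] \<open>a \<in> M\<close>] Min_arc by simp
      then show "a \<in> (\<lambda>c. {f c, g c}) ` {1..n}" using \<open>c \<in> {1..n}\<close> by blast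
    qed (use arc in auto)
  qed
  define T where "T = restrict (\<lambda>(r, c). if r = 1 then f c else g c) (cells n)"
  have T: "T (1, c) = f c" "T (2, c) = g c" if "c \<in> {1..n}" for c
    using that by (simp_all add: T_def cells_def)
  have "bij_betw T (cells n) {1..2 * n}"
    unfolding bij_betw_def
  proof
    have dist: "f c \<noteq> f d \<and> f c \<noteq> g d \<and> g c \<noteq> g d" if "c \<in> {1..n}" "d \<in> {1..n}" "c \<noteq> d" for c d
    proof -
      have "{f c, g c} \<noteq> {f d, g d}" using inj_onD[OF bij_betw_imp_inj_on[OF bij] _ that(1,2)] that(3) by blast
      then have "x \<notin> {f c, g c} \<or> x \<notin> {f d, g d}" for x
        using matching_disjoint[OF M arc(1)[OF that(1)] arc(1)[OF that(2)]] by metis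
      from this[of "f c"] this[of "g c"] show ?thesis by simp
    qed
    show "inj_on T (cells n)"
    proof (rule inj_onI)
      fix x y assume "x \<in> cells n" "y \<in> cells n" and eq: "T x = T y"
      then obtain r c r' d where x: "x = (r, c)" "r = 1 \<or> r = 2" "c \<in> {1..n}"
        and y: "y = (r', d)" "r' = 1 \<or> r' = 2" "d \<in> {1..n}"
        unfolding cells_def by blast
      have Tx: "T x = f c \<and> r = 1 \<or> T x = g c \<and> r = 2" using x T[of c] by blast
      have Ty: "T y = f d \<and> r' = 1 \<or> T y = g d \<and> r' = 2" using y T[of d] by blast
      have "c = d"
      proof (rule ccontr)
        assume "c \<noteq> d"
        then show False using dist[OF x(3) y(3)] dist[OF y(3) x(3)] Tx Ty eq by metis
      qed
      moreover have "f c \<noteq> g c" using arc(2)[OF x(3)] by simp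
      ultimately show "x = y" using Tx Ty eq x(1) y(1) by auto
    qed
    show "T ` cells n = {1..2 * n}"
    proof (intro subset_antisym subsetI)
      fix x assume "x \<in> T ` cells n"
      then obtain c where "c \<in> {1..n}" "x = f c \<or> x = g c" using T unfolding cells_def by blast
      then show "x \<in> {1..2 * n}" using matching_arcD[OF M arc(1)] by blast
    next
      fix x assume "x \<in> {1..2 * n}"
      then obtain y where "{x, y} \<in> M" using matching_arc_exists[OF M] by metis
      then obtain c where c: "c \<in> {1..n}" "{x, y} = {f c, g c}" using bij_betw_imp_surj_on[OF bij] by blast
      then have "x = T (1, c) \<or> x = T (2, c)" using T[OF c(1)] by (metis insert_iff empty_iff)
      moreover have "(1, c) \<in> cells n" "(2, c) \<in> cells n" using c by (auto simp: cells_def)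
      ultimately show "x \<in> T ` cells n" by blast
    qed
  qed
  then have "T \<in> tableaux n" by (simp add: tableaux_def T_def)
  moreover have "bij_betw (\<lambda>c. {T (1, c), T (2, c)}) {1..n} M"
    using bij by (subst bij_betw_cong[where g = "\<lambda>c. {f c, g c}"]) (simp_all only: T)
  moreover have "f c < f d" if "c \<in> {1..n}" "d \<in> {1..n}" "c < d" for c d
    using that by (auto simp: f_def intro!: strict_mono_onD[OF mono])
  then have "T (1, c) < T (1, d)" if "c \<in> {1..n}" "d \<in> {1..n}" "c < d" for c d
    using that by (simp only: T)
  moreover have "T (1, c) < T (2, c)" if "c \<in> {1..n}" for c
    using arc(2)[OF that] by (simp only: T[OF that])
  ultimately show ?thesis unfolding lists_arcs_def by blast
qed

text \<open>Keeping \<open>\<sigma>\<close> inside the factors describes the action on the vector of a matching without having to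
  decide which endpoints of the permuted arcs are on the left.\<close>

lemma specht_vec_tab_perm_lists_arcs:
  assumes T: "lists_arcs n T M" and s: "\<sigma> permutes {1..2 * n}"
  shows "specht_vec n (tab_perm n \<sigma> T) X = (if X \<in> tabloid n ` tableaux n
    then \<Prod>a\<in>M. of_bool (\<sigma> (Min a) \<in> first_row n X) - of_bool (\<sigma> (Max a) \<in> first_row n X) else 0)"
proof -
  let ?h = "\<lambda>a. of_bool (\<sigma> (Min a) \<in> first_row n X) - of_bool (\<sigma> (Max a) \<in> first_row n X) :: complex"
  have M: "bij_betw (\<lambda>c. {T (1, c), T (2, c)}) {1..n} M" using T by (simp only: lists_arcs_def)
  have "prod ?h M = (\<Prod>c\<in>{1..n}. ?h {T (1, c), T (2, c)})"
    by (rule prod.reindex_bij_betw[OF M, symmetric])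
  also have "\<dots> = (\<Prod>c\<in>{1..n}. of_bool (tab_perm n \<sigma> T (1, c) \<in> first_row n X)
      - of_bool (tab_perm n \<sigma> T (2, c) \<in> first_row n X))"
    using T unfolding lists_arcs_def by (intro prod.cong) (simp_all add: tab_perm_cell min_def max_def less_imp_le)
  finally show ?thesis
    using T s by (simp add: lists_arcs_def specht_vec_apply tab_perm_in_tableaux)
qed

lemma specht_vec_lists_arcs:
  assumes T: "lists_arcs n T M"
  shows "specht_vec n T = matching_vec n M"
  using specht_vec_tab_perm_lists_arcs[OF T permutes_id] T
  by (simp add: fun_eq_iff matching_vec_def bracket_def tab_perm_id lists_arcs_def)

lemma columns_matching:
  assumes T: "T \<in> tableaux n"
  shows "(\<lambda>c. {T (1, c), T (2, c)}) ` {1..n} \<in> matchings n"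
    and "inj_on (\<lambda>c. {T (1, c), T (2, c)}) {1..n}"
proof -
  let ?M = "(\<lambda>c. {T (1, c), T (2, c)}) ` {1..n}"
  have d: "{T (1, c), T (2, c)} \<inter> {T (1, d), T (2, d)} = {}"
    if "c \<in> {1..n}" "d \<in> {1..n}" "c \<noteq> d" for c d
    using tableau_entry_eq_iff[OF T] that by auto
  then show "inj_on (\<lambda>c. {T (1, c), T (2, c)}) {1..n}" by (auto intro!: inj_onI) blast
  have "\<Union>?M = {1..2 * n}"
  proof (intro subset_antisym subsetI)
    fix x assume "x \<in> \<Union>?M"
    then show "x \<in> {1..2 * n}" using tableau_entry[OF T] by blast
  next
    fix x assume "x \<in> {1..2 * n}"
    then show "x \<in> \<Union>?M" by (elim tableau_entry_cases[OF T]) auto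
  qed
  moreover have "disjoint ?M" unfolding disjoint_def using d by blast
  moreover have c2: "\<forall>a\<in>?M. card a = 2"
  proof
    fix a assume "a \<in> ?M"
    then obtain c where "c \<in> {1..n}" "a = {T (1, c), T (2, c)}" by blast
    moreover from this have "T (1, c) \<noteq> T (2, c)" using tableau_entry_eq_iff[OF T] by simp
    ultimately show "card a = 2" by simp
  qed
  moreover have "{} \<notin> ?M" by auto
  ultimately show "?M \<in> matchings n" unfolding matchings_def partition_on_def by blast
qed

text \<open>Each column with the larger entry on top contributes a sign.\<close>

lemma specht_vec_eq_signed_matching_vec:
  assumes T: "T \<in> tableaux n"
  obtains s where "specht_vec n T = cscale s (matching_vec n ((\<lambda>c. {T (1, c), T (2, c)}) ` {1..n}))"
proof -
  let ?A = "\<lambda>c. {T (1, c), T (2, c)}"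
  define s where "s = (\<Prod>c\<in>{1..n}. if T (1, c) < T (2, c) then 1 else - 1 :: complex)"
  have "(\<Prod>c\<in>{1..n}. of_bool (T (1, c) \<in> S) - of_bool (T (2, c) \<in> S)) = s * prod (bracket S) (?A ` {1..n})" for S
    unfolding s_def prod.reindex[OF columns_matching(2)[OF T]] prod.distrib[symmetric]
  proof (intro prod.cong HOL.refl)
    fix c assume "c \<in> {1..n}"
    then have "T (1, c) \<noteq> T (2, c)" using tableau_entry_eq_iff[OF T] by simp
    then show "of_bool (T (1, c) \<in> S) - of_bool (T (2, c) \<in> S) =
      (if T (1, c) < T (2, c) then 1 else - 1) * (bracket S \<circ> ?A) c"
      using bracket_arc[of "T (1, c)" "T (2, c)" S] bracket_arc[of "T (2, c)" "T (1, c)" S]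
      by (auto simp: insert_commute not_less_iff_gr_or_eq simp del: One_nat_def)
  qed
  then have "specht_vec n T = cscale s (matching_vec n (?A ` {1..n}))"
    by (simp add: fun_eq_iff specht_vec_apply[OF T] cscale_def matching_vec_def)
  then show thesis by (rule that)
qed

section \<open>Straightening and triangularity\<close>

definition arc_weight :: "(nat \<Rightarrow> nat) \<Rightarrow> web \<Rightarrow> nat" where
  "arc_weight g M = (\<Sum>a\<in>M. g (Max a - Min a))"

lemma arc_weight_two_arcs:
  assumes "finite R" "\<Union>R \<inter> {a, b, c, d} = {}" "distinct [a, b, c, d]" "a < b" "c < d"
  shows "arc_weight g (insert {a, b} (insert {c, d} R)) = g (b - a) + g (d - c) + arc_weight g R"
  using assms unfolding arc_weight_def by (subst sum_two_arcs) (auto simp: min_def max_def)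

lemma webs_iff:
  "w \<in> webs n \<longleftrightarrow> w \<in> matchings n \<and>
    \<not> (\<exists>a b c d. a < b \<and> b < c \<and> c < d \<and> {a, c} \<in> w \<and> {b, d} \<in> w)"
  unfolding webs_def matchings_def by blast

lemma web_noncrossing:
  assumes "w \<in> webs n" "{a, c} \<in> w" "{b, d} \<in> w" "a < b" "b < c" "c < d"
  shows False
  using assms unfolding webs_iff by blast

lemma finite_webs: "finite (webs n)"
  by (rule finite_subset[OF _ finite_matchings]) (auto simp: webs_iff)

text \<open>A function of the arc length that is strictly increasing and strictly concave on
  \<open>{0..2 * n}\<close> decreases in total under both resolutions of a crossing.  The disjoint arcs are shorter than
  the crossing ones; the nested arcs have the same total length but are spread further apart.\<close>

lemma uncross_arcs_decrease:
  fixes a b c d n :: nat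
  defines "g \<equiv> \<lambda>L. L * (4 * n - L)"
  assumes "a < b" "b < c" "c < d" "d \<le> 2 * n"
  shows "g (b - a) + g (d - c) < g (c - a) + g (d - b)"
    and "g (d - a) + g (c - b) < g (c - a) + g (d - b)"
proof -
  obtain p where p: "b = a + p" "p > 0" using assms(2) by (metis less_imp_add_positive)
  obtain q where q: "c = b + q" "q > 0" using assms(3) by (metis less_imp_add_positive)
  obtain r where r: "d = c + r" "r > 0" using assms(4) by (metis less_imp_add_positive)
  obtain t where t: "2 * n = d + t" using assms(5) by (metis le_Suc_ex)
  define u where "u = a + t"
  have n: "4 * n = 2 * (p + q + r + u)" using t p q r by (simp add: u_def)
  have diff: "b - a = p" "d - c = r" "c - a = p + q" "d - b = q + r" "d - a = p + q + r" "c - b = q"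
    using p q r by auto
  have sub: "4 * n - p = p + 2 * q + 2 * r + 2 * u" "4 * n - q = q + 2 * p + 2 * r + 2 * u"
    "4 * n - r = r + 2 * p + 2 * q + 2 * u" "4 * n - (p + q) = p + q + 2 * r + 2 * u"
    "4 * n - (q + r) = q + r + 2 * p + 2 * u" "4 * n - (p + q + r) = p + q + r + 2 * u"
    unfolding n by simp_all
  have pos: "p * q > 0" "p * r > 0" "q * r > 0" "q * q > 0" using p q r by simp_all
  show "g (b - a) + g (d - c) < g (c - a) + g (d - b)"
    using pos unfolding g_def diff sub by (simp add: algebra_simps)
  show "g (d - a) + g (c - b) < g (c - a) + g (d - b)"
    using pos unfolding g_def diff sub by (simp add: algebra_simps)
qed

lemma matching_vec_in_span_webs:
  "M \<in> matchings n \<Longrightarrow> matching_vec n M \<in> cfun.span (matching_vec n ` webs n)"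
proof (induction M rule: measure_induct_rule[where f = "arc_weight (\<lambda>L. L * (4 * n - L))"])
  case (less M)
  let ?V = "cfun.span (matching_vec n ` webs n)"
  show ?case
  proof (cases "M \<in> webs n")
    case True
    then show ?thesis by (intro cfun.span_base) simp
  next
    case False
    then obtain a b c d where ord: "a < b" "b < c" "c < d" and arcs: "{a, c} \<in> M" "{b, d} \<in> M"
      using less.prems unfolding webs_iff by blast
    have "{a, c} \<noteq> {b, d}" using ord by (auto simp: doubleton_eq_iff)
    then obtain R where M: "M = insert {a, c} (insert {b, d} R)"
      and R: "finite R" "\<Union>R \<inter> {a, c, b, d} = {}"
      using matching_two_arcs[OF less.prems arcs] by metis
    have R': "\<Union>R \<inter> {a, b, c, d} = {}" "\<Union>R \<inter> {a, d, b, c} = {}" using R(2) by auto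
    have d: "d \<le> 2 * n" using matching_arcD[OF less.prems arcs(2)] by simp
    let ?M1 = "insert {a, b} (insert {c, d} R)" and ?M2 = "insert {a, d} (insert {b, c} R)"
    have m: "?M1 \<in> matchings n" "?M2 \<in> matchings n"
      using ord by (auto intro!: matching_replace_arcs[OF less.prems[unfolded M] R(2)])
    have dist: "distinct [a, c, b, d]" "distinct [a, b, c, d]" "distinct [a, d, b, c]"
      and ord1: "a < c" "b < d" "a < d" "a < b" "c < d" "b < c" using ord by simp_all
    note w = arc_weight_two_arcs[OF R(1) R(2) dist(1) ord1(1) ord1(2)]
      arc_weight_two_arcs[OF R(1) R'(1) dist(2) ord1(4) ord1(5)]
      arc_weight_two_arcs[OF R(1) R'(2) dist(3) ord1(3) ord1(6)]
    have "matching_vec n ?M1 \<in> ?V"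
      by (rule less.IH[OF _ m(1)]) (use uncross_arcs_decrease(1)[OF ord d] in \<open>simp add: M w\<close>)
    moreover have "matching_vec n ?M2 \<in> ?V"
      by (rule less.IH[OF _ m(2)]) (use uncross_arcs_decrease(2)[OF ord d] in \<open>simp add: M w\<close>)
    ultimately show ?thesis
      unfolding M matching_vec_pluecker[OF R(1) R'(1) ord] by (rule cfun.span_add)
  qed
qed

definition nonnesting :: "web \<Rightarrow> bool" where
  "nonnesting M \<longleftrightarrow> \<not> (\<exists>a b c d. a < b \<and> b < c \<and> c < d \<and> {a, d} \<in> M \<and> {b, c} \<in> M)"

text \<open>For nestings the weight must instead be convex, since now the nested arcs are the ones to be replaced.\<close>

lemma unnest_arcs_decrease:
  fixes a b c d :: nat
  assumes "a < b" "b < c" "c < d"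
  shows "(c - a)\<^sup>2 + (d - b)\<^sup>2 < (d - a)\<^sup>2 + (c - b)\<^sup>2"
    and "(b - a)\<^sup>2 + (d - c)\<^sup>2 < (d - a)\<^sup>2 + (c - b)\<^sup>2"
proof -
  obtain p where p: "b = a + p" "p > 0" using assms(1) by (metis less_imp_add_positive)
  obtain q where q: "c = b + q" "q > 0" using assms(2) by (metis less_imp_add_positive)
  obtain r where r: "d = c + r" "r > 0" using assms(3) by (metis less_imp_add_positive)
  have diff: "b - a = p" "d - c = r" "c - a = p + q" "d - b = q + r" "d - a = p + q + r" "c - b = q"
    using p q r by auto
  have pos: "p * q > 0" "p * r > 0" "q * r > 0" "q * q > 0" using p q r by simp_all
  show "(c - a)\<^sup>2 + (d - b)\<^sup>2 < (d - a)\<^sup>2 + (c - b)\<^sup>2"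
    using pos unfolding diff by (simp add: algebra_simps power2_eq_square)
  show "(b - a)\<^sup>2 + (d - c)\<^sup>2 < (d - a)\<^sup>2 + (c - b)\<^sup>2"
    using pos unfolding diff by (simp add: algebra_simps power2_eq_square)
qed

lemma matching_vec_in_span_nonnesting:
  "M \<in> matchings n \<Longrightarrow>
    matching_vec n M \<in> cfun.span (matching_vec n ` {N \<in> matchings n. nonnesting N})"
proof (induction M rule: measure_induct_rule[where f = "arc_weight (\<lambda>L. L\<^sup>2)"])
  case (less M)
  let ?V = "cfun.span (matching_vec n ` {N \<in> matchings n. nonnesting N})"
  show ?case
  proof (cases "nonnesting M")
    case True
    then show ?thesis using less.prems by (intro cfun.span_base) simp
  next
    case False
    then obtain a b c d where ord: "a < b" "b < c" "c < d" and arcs: "{a, d} \<in> M" "{b, c} \<in> M"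
      unfolding nonnesting_def by blast
    have "{a, d} \<noteq> {b, c}" using ord by (auto simp: doubleton_eq_iff)
    then obtain R where M: "M = insert {a, d} (insert {b, c} R)"
      and R: "finite R" "\<Union>R \<inter> {a, d, b, c} = {}"
      using matching_two_arcs[OF less.prems arcs] by metis
    have R': "\<Union>R \<inter> {a, b, c, d} = {}" "\<Union>R \<inter> {a, c, b, d} = {}" using R(2) by auto
    let ?M1 = "insert {a, c} (insert {b, d} R)" and ?M2 = "insert {a, b} (insert {c, d} R)"
    have m: "?M1 \<in> matchings n" "?M2 \<in> matchings n"
      using ord by (auto intro!: matching_replace_arcs[OF less.prems[unfolded M] R(2)])
    have dist: "distinct [a, c, b, d]" "distinct [a, b, c, d]" "distinct [a, d, b, c]"
      and ord1: "a < c" "b < d" "a < d" "a < b" "c < d" "b < c" using ord by simp_all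
    note w = arc_weight_two_arcs[OF R(1) R'(2) dist(1) ord1(1) ord1(2)]
      arc_weight_two_arcs[OF R(1) R'(1) dist(2) ord1(4) ord1(5)]
      arc_weight_two_arcs[OF R(1) R(2) dist(3) ord1(3) ord1(6)]
    have "matching_vec n ?M1 \<in> ?V"
      by (rule less.IH[OF _ m(1)]) (use unnest_arcs_decrease(1)[OF ord] in \<open>simp add: M w\<close>)
    moreover have "matching_vec n ?M2 \<in> ?V"
      by (rule less.IH[OF _ m(2)]) (use unnest_arcs_decrease(2)[OF ord] in \<open>simp add: M w\<close>)
    moreover have "matching_vec n M = matching_vec n ?M1 - matching_vec n ?M2"
      unfolding M matching_vec_pluecker[OF R(1) R'(1) ord] by simp
    ultimately show ?thesis by (simp only: cfun.span_diff)
  qed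
qed

lemma specht_module_eq_span_matchings:
  "specht_module n = cfun.span (matching_vec n ` matchings n)"
proof (rule subset_antisym)
  show "specht_module n \<subseteq> cfun.span (matching_vec n ` matchings n)"
    unfolding specht_module_def
  proof (intro cfun.span_minimal cfun.subspace_span image_subsetI)
    fix T assume T: "T \<in> tableaux n"
    obtain s where "specht_vec n T = cscale s (matching_vec n ((\<lambda>c. {T (1, c), T (2, c)}) ` {1..n}))"
      using specht_vec_eq_signed_matching_vec[OF T] .
    then show "specht_vec n T \<in> cfun.span (matching_vec n ` matchings n)"
      using columns_matching(1)[OF T] by (simp add: cfun.span_base cfun.span_scale del: One_nat_def)
  qed
  have "matching_vec n ` matchings n \<subseteq> specht_vec n ` tableaux n"
  proof (rule image_subsetI)
    fix M assume "M \<in> matchings n"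
    then obtain T where T: "lists_arcs n T M" using exists_lists_arcs by blast
    then have "T \<in> tableaux n" by (simp add: lists_arcs_def)
    then show "matching_vec n M \<in> specht_vec n ` tableaux n"
      by (intro image_eqI[of _ _ T] specht_vec_lists_arcs[OF T, symmetric])
  qed
  then show "cfun.span (matching_vec n ` matchings n) \<subseteq> specht_module n"
    unfolding specht_module_def by (rule cfun.span_mono)
qed

lemma specht_module_eq_span_webs: "specht_module n = cfun.span (matching_vec n ` webs n)"
proof -
  have "matching_vec n ` matchings n \<subseteq> cfun.span (matching_vec n ` webs n)"
    using matching_vec_in_span_webs by blast
  moreover have "matching_vec n ` webs n \<subseteq> cfun.span (matching_vec n ` matchings n)"
    using cfun.span_superset by (force simp: webs_iff)
  ultimately show ?thesis unfolding specht_module_eq_span_matchings cfun.span_eq by blast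
qed

text \<open>If the arcs are listed by increasing left endpoint, then a descent in the second row is a nested pair.\<close>

lemma nonnesting_vec_standard:
  assumes M: "M \<in> matchings n" and N: "nonnesting M"
  shows "matching_vec n M \<in> specht_vec n ` standard_tableaux n"
proof -
  obtain T where l: "lists_arcs n T M"
    and mono: "\<And>c d. c \<in> {1..n} \<Longrightarrow> d \<in> {1..n} \<Longrightarrow> c < d \<Longrightarrow> T (1, c) < T (1, d)"
    using exists_lists_arcs[OF M] by blast
  have T: "T \<in> tableaux n" and b: "bij_betw (\<lambda>c. {T (1, c), T (2, c)}) {1..n} M"
    and asc: "\<And>c. c \<in> {1..n} \<Longrightarrow> T (1, c) < T (2, c)" using l by (simp_all add: lists_arcs_def)
  have "T (2, c) < T (2, d)" if cd: "c \<in> {1..n}" "d \<in> {1..n}" "c < d" for c d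
  proof (rule ccontr)
    assume "\<not> T (2, c) < T (2, d)"
    moreover have "T (2, c) \<noteq> T (2, d)" using tableau_entry_eq_iff[OF T, of 2 c 2 d] cd by simp
    ultimately have "T (2, d) < T (2, c)" by simp
    moreover have "{T (1, c), T (2, c)} \<in> M" "{T (1, d), T (2, d)} \<in> M"
      using b cd by (auto simp: bij_betw_def)
    ultimately show False using N mono[OF cd] asc[OF cd(2)] unfolding nonnesting_def by blast
  qed
  then have "T \<in> standard_tableaux n" using T asc mono by (auto simp: standard_tableaux_def)
  then show ?thesis by (intro image_eqI[of _ _ T] specht_vec_lists_arcs[OF l, symmetric])
qed

lemma specht_module_eq_span_standard:
  "specht_module n = cfun.span (specht_vec n ` standard_tableaux n)"
proof (rule subset_antisym)
  have "cfun.span (matching_vec n ` {N \<in> matchings n. nonnesting N})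
      \<subseteq> cfun.span (specht_vec n ` standard_tableaux n)"
    using nonnesting_vec_standard by (intro cfun.span_mono) blast
  then have "matching_vec n ` matchings n \<subseteq> cfun.span (specht_vec n ` standard_tableaux n)"
    using matching_vec_in_span_nonnesting by blast
  then show "specht_module n \<subseteq> cfun.span (specht_vec n ` standard_tableaux n)"
    unfolding specht_module_eq_span_matchings by (intro cfun.span_minimal cfun.subspace_span)
  show "cfun.span (specht_vec n ` standard_tableaux n) \<subseteq> specht_module n"
    unfolding specht_module_def standard_tableaux_def by (intro cfun.span_mono) blast
qed

lemma left_endpoint_iff:
  assumes M: "M \<in> matchings n"
  shows "x \<in> Min ` M \<longleftrightarrow> (\<exists>y>x. {x, y} \<in> M)"
proof
  assume "x \<in> Min ` M"
  then obtain a where a: "a \<in> M" "x = Min a" by blast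
  obtain i j where "a = {i, j}" "i < j" using matching_arcE[OF M a(1)] by metis
  then show "\<exists>y>x. {x, y} \<in> M" using a by (auto simp: min_def)
next
  assume "\<exists>y>x. {x, y} \<in> M"
  then obtain y where "y > x" "{x, y} \<in> M" by blast
  then show "x \<in> Min ` M" by (intro image_eqI[of _ _ "{x, y}"]) (auto simp: min_def)
qed

text \<open>Scanning the points from left to right, each right endpoint must be joined to the nearest left endpoint
  that is still open: if the two webs disagreed at \<open>b\<close>, then in one of them the arc at \<open>b\<close> would cross the
  arc at the other candidate.  This is the inductive step of that argument.\<close>

lemma web_arc_transfer:
  assumes w: "w \<in> webs n" and v: "v \<in> webs n" and eq: "Min ` w = Min ` v"
    and IH: "\<And>x y. x < y \<Longrightarrow> y < b \<Longrightarrow> {x, y} \<in> w \<longleftrightarrow> {x, y} \<in> v"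
    and ab: "a < b" "{a, b} \<in> w"
  shows "{a, b} \<in> v"
proof -
  have wm: "w \<in> matchings n" and vm: "v \<in> matchings n" using w v by (simp_all add: webs_iff)
  note uw = matching_arc_unique[OF wm] and uv = matching_arc_unique[OF vm]
  obtain a' where a': "{b, a'} \<in> v"
    using matching_arc_exists[OF vm] matching_arcD(3)[OF wm ab(2)] by metis
  have "b \<notin> Min ` w"
  proof
    assume "b \<in> Min ` w"
    then obtain y where "y > b" "{b, y} \<in> w" using left_endpoint_iff[OF wm] by blast
    then show False using uw[of b y a] ab by (simp add: insert_commute)
  qed
  then have "\<not> a' > b" using a' left_endpoint_iff[OF vm] eq by blast
  moreover have "a' \<noteq> b" using matching_arcD(1)[OF vm a'] by simp
  ultimately have lt: "a' < b" by simp
  have a'b: "{a', b} \<in> v" using a' by (simp add: insert_commute)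
  show ?thesis
  proof (cases a a' rule: linorder_cases)
    case equal
    then show ?thesis using a'b by simp
  next
    case less
    have "a' \<in> Min ` w" using a'b lt left_endpoint_iff[OF vm] eq by blast
    then obtain c where c: "c > a'" "{a', c} \<in> w" using left_endpoint_iff[OF wm] by blast
    have "c \<noteq> b" using uw[of b a a'] ab c less by (auto simp: insert_commute)
    moreover have "\<not> c < b" using IH[OF c(1)] c(2) uv[OF _ a'b] \<open>c \<noteq> b\<close> by blast
    ultimately have "b < c" by simp
    then show ?thesis using web_noncrossing[OF w ab(2) c(2) less lt] by blast
  next
    case greater
    have "a \<in> Min ` v" using ab left_endpoint_iff[OF wm] eq by blast
    then obtain c where c: "c > a" "{a, c} \<in> v" using left_endpoint_iff[OF vm] by blast
    have "c \<noteq> b" using uv[of b a a'] a' c greater by (auto simp: insert_commute)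
    moreover have "\<not> c < b" using IH[OF c(1)] c(2) uw[OF _ ab(2)] \<open>c \<noteq> b\<close> by blast
    ultimately have "b < c" by simp
    then show ?thesis using web_noncrossing[OF v a'b c(2) greater ab(1)] by blast
  qed
qed

lemma web_eq_of_left_endpoints:
  assumes w: "w \<in> webs n" and v: "v \<in> webs n" and eq: "Min ` w = Min ` v"
  shows "w = v"
proof -
  have "{x, y} \<in> w \<longleftrightarrow> {x, y} \<in> v" if "x < y" for x y
    using that
  proof (induction y arbitrary: x rule: less_induct)
    case (less b)
    then show ?case
      using web_arc_transfer[OF w v eq] web_arc_transfer[OF v w eq[symmetric]] by blast
  qed
  moreover have wm: "w \<in> matchings n" using w by (simp add: webs_iff)
  ultimately have "w \<subseteq> v" using matching_arcE[OF wm] by (metis subsetI)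
  then show ?thesis using wm v matching_subset_eq by (auto simp: webs_iff)
qed

lemma exists_tabloid_left_endpoints:
  assumes M: "M \<in> matchings n"
  shows "\<exists>X\<in>tabloid n ` tableaux n. first_row n X = Min ` M"
proof -
  obtain T where "lists_arcs n T M" using exists_lists_arcs[OF M] by blast
  then have T: "T \<in> tableaux n" and b: "bij_betw (\<lambda>c. {T (1, c), T (2, c)}) {1..n} M"
    and asc: "\<And>c. c \<in> {1..n} \<Longrightarrow> T (1, c) < T (2, c)" by (simp_all add: lists_arcs_def)
  have "Min ` M = (\<lambda>c. Min {T (1, c), T (2, c)}) ` {1..n}"
    using bij_betw_imp_surj_on[OF b] by (metis image_image)
  also have "\<dots> = (\<lambda>c. T (1, c)) ` {1..n}"
    using asc by (intro image_cong) (auto simp: min_def less_imp_le)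
  also have "\<dots> = first_row n (tabloid n T)"
    unfolding first_row_tabloid[OF T] by auto
  finally show ?thesis using T by auto
qed

lemma matching_vec_left_endpoints_nonzero:
  assumes M: "M \<in> matchings n" and X: "X \<in> tabloid n ` tableaux n" "first_row n X = Min ` M"
  shows "matching_vec n M X \<noteq> 0"
proof -
  have "bracket (Min ` M) a \<noteq> 0" if a: "a \<in> M" for a
  proof -
    obtain i j where ij: "a = {i, j}" "i < j" using matching_arcE[OF M a] by metis
    have "i \<in> Min ` M" using a ij left_endpoint_iff[OF M] by blast
    moreover have "j \<notin> Min ` M"
    proof
      assume "j \<in> Min ` M"
      then obtain y where "y > j" "{j, y} \<in> M" using left_endpoint_iff[OF M] by blast
      then show False using matching_arc_unique[OF M, of j y i] a ij by (simp add: insert_commute)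
    qed
    ultimately show ?thesis using ij by (simp add: bracket_arc)
  qed
  then show ?thesis using X finite_matching[OF M] by (simp add: matching_vec_def)
qed

text \<open>A nonzero coefficient means that the first row contains exactly one endpoint of each arc of \<open>M\<close>.  The sum
  of these endpoints is at least the sum of the left endpoints, with equality only if all of them are
  left endpoints.\<close>

lemma matching_vec_triangular:
  assumes M: "M \<in> matchings n" and N: "N \<in> matchings n"
    and X: "first_row n X = Min ` N" and nz: "matching_vec n M X \<noteq> 0"
  shows "sum Min M \<le> sum Min N" "sum Min M = sum Min N \<Longrightarrow> Min ` M = Min ` N"
proof -
  let ?S = "Min ` N"
  have S: "?S \<subseteq> {1..2 * n}" using left_endpoint_iff[OF N] matching_arcD[OF N] by blast
  have fin: "finite M" by (rule finite_matching[OF M])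
  have br: "bracket ?S a \<noteq> 0" if "a \<in> M" for a
    using nz that fin X by (auto simp: matching_vec_def split: if_splits)
  have le: "Min a \<le> \<Sum>(a \<inter> ?S)" and imp: "Min a = \<Sum>(a \<inter> ?S) \<Longrightarrow> Min a \<in> ?S" if a: "a \<in> M" for a
  proof -
    obtain i j where ij: "a = {i, j}" "i < j" using matching_arcE[OF M a] by metis
    then have "i \<in> ?S \<and> j \<notin> ?S \<or> i \<notin> ?S \<and> j \<in> ?S"
      using br[OF a] by (auto simp: bracket_arc split: if_splits)
    then have "a \<inter> ?S = {i} \<and> i \<in> ?S \<or> a \<inter> ?S = {j}" using ij by auto
    then show "Min a \<le> \<Sum>(a \<inter> ?S)" "Min a = \<Sum>(a \<inter> ?S) \<Longrightarrow> Min a \<in> ?S"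
      using ij by (auto simp: min_def)
  qed
  have "\<Union>M = {1..2 * n}" using M by (auto simp: matchings_def dest: partition_onD1)
  then have "?S = (\<Union>a\<in>M. a \<inter> ?S)" using S by blast
  then have "\<Sum>?S = \<Sum>(\<Union>a\<in>M. a \<inter> ?S)" by simp
  also have "\<dots> = (\<Sum>a\<in>M. \<Sum>(a \<inter> ?S))"
    using fin finite_matching[OF N] matching_disjoint[OF M]
    by (intro sum.UNION_disjoint) auto
  finally have "\<Sum>?S = (\<Sum>a\<in>M. \<Sum>(a \<inter> ?S))" .
  moreover have "\<Sum>?S = sum Min N" using sum.reindex[OF inj_on_Min_matching[OF N]] by (simp add: comp_def)
  ultimately have sum: "sum Min N = (\<Sum>a\<in>M. \<Sum>(a \<inter> ?S))" by simp
  then show "sum Min M \<le> sum Min N" using le by (simp add: sum_mono)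
  assume "sum Min M = sum Min N"
  then have "sum Min M = (\<Sum>a\<in>M. \<Sum>(a \<inter> ?S))" using sum by simp
  then have "Min a = \<Sum>(a \<inter> ?S)" if "a \<in> M" for a
    by (rule sum_mono_inv[OF _ le that fin])
  then have "Min ` M \<subseteq> ?S" using imp by blast
  moreover have "card (Min ` M) = card ?S"
    using M N by (simp add: card_image inj_on_Min_matching card_matching)
  ultimately show "Min ` M = ?S" using finite_matching[OF N] by (simp add: card_subset_eq)
qed

section \<open>The equivariant embedding of webs\<close>

lemma linear_on_eq_on_span:
  assumes f: "linear_on (cfun.span S) f" and g: "linear_on (cfun.span S) g"
    and eq: "\<And>x. x \<in> S \<Longrightarrow> f x = g x" and x: "x \<in> cfun.span S"
  shows "f x = g x"
proof -
  have "x \<in> cfun.span S \<and> f x = g x"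
    using x
  proof (induction x rule: cfun.span_induct_alt)
    case base
    have "f (cscale 0 0) = cscale 0 (f 0)" "g (cscale 0 0) = cscale 0 (g 0)"
      using f g cfun.span_zero[of S] unfolding linear_on_def by blast+
    then have "f 0 = 0" "g 0 = 0" by (simp_all only: cfun.scale_zero_left)
    then show ?case using cfun.span_zero[of S] by metis
  next
    case (step c x y)
    then have "x \<in> cfun.span S" "cscale c x \<in> cfun.span S" "y \<in> cfun.span S"
      by (auto intro: cfun.span_base cfun.span_scale)
    then have "f (cscale c x + y) = cscale c (f x) + f y" "g (cscale c x + y) = cscale c (g x) + g y"
      "cscale c x + y \<in> cfun.span S"
      using f g unfolding linear_on_def by (metis, metis, metis cfun.span_add)
    then show ?case using step eq by metis
  qed
  then show ?thesis ..
qed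

lemma linear_on_lin_ext: "linear_on V (lin_ext B f)"
  by (simp add: linear_on_def lin_ext_add lin_ext_scale)

lemma linear_on_lin_ext_compose: "linear_on V h \<Longrightarrow> linear_on V (\<lambda>x. lin_ext B f (h x))"
  by (simp add: linear_on_def lin_ext_add lin_ext_scale)

lemma lin_ext_image_span: "lin_ext B f ` cfun.span S = cfun.span (lin_ext B f ` S)"
proof -
  have "module_hom cscale cscale (lin_ext B f)"
    by unfold_locales (simp_all add: lin_ext_add lin_ext_scale)
  then show ?thesis by (rule module_hom.span_image[symmetric])
qed

lemma web_module_iff: "x \<in> web_module n \<longleftrightarrow> (\<forall>w. w \<notin> webs n \<longrightarrow> x w = 0)"
proof
  assume "x \<in> web_module n"
  then show "\<forall>w. w \<notin> webs n \<longrightarrow> x w = 0"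
    unfolding web_module_def
    by (induction x rule: cfun.span_induct_alt) (auto simp: basis_vec_def cscale_def split: if_splits)
next
  assume "\<forall>w. w \<notin> webs n \<longrightarrow> x w = 0"
  then have "x = (\<Sum>w\<in>webs n. cscale (x w) (basis_vec w))"
    by (auto simp: fun_eq_iff sum_apply cscale_def basis_vec_def finite_webs if_distrib cong: if_cong)
  also have "\<dots> \<in> web_module n"
    unfolding web_module_def by (intro cfun.span_sum cfun.span_scale cfun.span_base imageI)
  finally show "x \<in> web_module n" .
qed

definition web_embedding :: "nat \<Rightarrow> (web \<Rightarrow> complex) \<Rightarrow> (tableau set \<Rightarrow> complex)" where
  "web_embedding n = lin_ext (webs n) (matching_vec n)"

lemma web_embedding_basis_vec: "w \<in> webs n \<Longrightarrow> web_embedding n (basis_vec w) = matching_vec n w"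
  by (simp add: web_embedding_def lin_ext_basis_vec finite_webs)

lemma web_embedding_image: "web_embedding n ` web_module n = specht_module n"
proof -
  have "web_embedding n ` basis_vec ` webs n = matching_vec n ` webs n"
    unfolding image_image by (intro image_cong) (simp_all add: web_embedding_basis_vec)
  then show ?thesis
    unfolding web_module_def specht_module_eq_span_webs
    by (simp add: web_embedding_def lin_ext_image_span)
qed

text \<open>Among the webs in the support of \<open>x\<close>, choose one with the smallest sum of left endpoints.  By
  triangularity no other web of the support contributes to the coefficient at the tabloid of its left
  endpoints.\<close>

lemma web_embedding_eq_0:
  assumes x: "x \<in> web_module n" and 0: "web_embedding n x = 0"
  shows "x = 0"
proof (rule ccontr)
  assume "x \<noteq> 0"
  then obtain w0 where "x w0 \<noteq> 0" by (auto simp: fun_eq_iff)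
  then obtain w where w: "x w \<noteq> 0" and least: "\<And>v. x v \<noteq> 0 \<Longrightarrow> sum Min w \<le> sum Min v"
    using ex_has_least_nat[of "\<lambda>w. x w \<noteq> 0" w0 "sum Min"] by blast
  have wW: "w \<in> webs n" using x w web_module_iff by blast
  then have wM: "w \<in> matchings n" by (simp add: webs_iff)
  obtain X where X: "X \<in> tabloid n ` tableaux n" "first_row n X = Min ` w"
    using exists_tabloid_left_endpoints[OF wM] by blast
  have zero: "x v * matching_vec n v X = 0" if v: "v \<in> webs n - {w}" for v
  proof (rule ccontr)
    assume "x v * matching_vec n v X \<noteq> 0"
    then have nz: "x v \<noteq> 0" "matching_vec n v X \<noteq> 0" by simp_all
    have vM: "v \<in> matchings n" using v by (simp add: webs_iff)
    note tri = matching_vec_triangular[OF vM wM X(2) nz(2)]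
    have "sum Min v = sum Min w" using tri(1) least[OF nz(1)] by simp
    then have "v = w" using tri(2) web_eq_of_left_endpoints wW v by blast
    then show False using v by simp
  qed
  have "web_embedding n x X = (\<Sum>v\<in>webs n. x v * matching_vec n v X)"
    by (simp add: web_embedding_def lin_ext_def sum_apply cscale_def)
  also have "\<dots> = x w * matching_vec n w X + (\<Sum>v\<in>webs n - {w}. x v * matching_vec n v X)"
    by (rule sum.remove[OF finite_webs wW])
  also have "\<dots> = x w * matching_vec n w X"
    by (subst sum.neutral) (use zero in auto)
  finally show False
    using 0 w matching_vec_left_endpoints_nonzero[OF wM X] by simp
qed

lemma inj_on_web_embedding: "inj_on (web_embedding n) (web_module n)"
proof (rule inj_onI)
  fix x y assume x: "x \<in> web_module n" and y: "y \<in> web_module n" and eq: "web_embedding n x = web_embedding n y"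
  have "web_embedding n (x + cscale (-1) y) = web_embedding n x + cscale (-1) (web_embedding n y)"
    by (simp only: web_embedding_def lin_ext_add lin_ext_scale)
  also have "\<dots> = 0" by (simp add: eq cscale_def fun_eq_iff)
  finally have "web_embedding n (x + cscale (-1) y) = 0" .
  moreover have "x + cscale (-1) y \<in> web_module n"
    using x y unfolding web_module_def by (intro cfun.span_add cfun.span_scale)
  ultimately have "x + cscale (-1) y = 0" by (rule web_embedding_eq_0[rotated])
  then show "x = y" by (simp add: fun_eq_iff cscale_def)
qed

subsection \<open>Reconnecting arcs\<close>

text \<open>Noncrossing in symmetric form: both endpoints of an arc lie on the same side of any other arc.  This
  avoids a case distinction on the order of the endpoints.\<close>

lemma web_same_side:
  assumes w: "w \<in> webs n" and arcs: "{p, q} \<in> w" "{x, y} \<in> w" and x: "x \<noteq> p" "x \<noteq> q" and pq: "p < q"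
  shows "p < x \<and> x < q \<longleftrightarrow> p < y \<and> y < q"
proof -
  have m: "w \<in> matchings n" using w by (simp add: webs_iff)
  have y: "y \<noteq> p" "y \<noteq> q"
    using matching_arc_unique[OF m, of p q x] matching_arc_unique[OF m, of q p x] arcs x
    by (auto simp: insert_commute)
  have arc': "{y, x} \<in> w" using arcs by (simp add: insert_commute)
  note c = web_noncrossing[OF w arcs(1) arcs(2)] web_noncrossing[OF w arcs(1) arc']
    web_noncrossing[OF w arcs(2) arcs(1)] web_noncrossing[OF w arc' arcs(1)]
  show ?thesis using c x y pq by (metis linorder_neqE_nat)
qed

text \<open>The new pairs cross no other arc \<open>(p, q)\<close>: the adjacent points \<open>i\<close> and \<open>i + 1\<close> are on the same side of it,
  and \<open>j\<close>, \<open>k\<close> are on the sides of \<open>i\<close>, \<open>i + 1\<close> respectively.\<close>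

lemma web_reconnectE:
  assumes w: "w \<in> webs n" and i: "i \<in> {1..<2 * n}" and no: "{i, i + 1} \<notin> w"
  obtains j k R where "w = insert {i, j} (insert {i + 1, k} R)" "finite R" "\<Union>R \<inter> {i, j, i + 1, k} = {}"
    "distinct [i, j, i + 1, k]" "web_reconnect i w = insert {i, i + 1} (insert {j, k} R)"
    "web_reconnect i w \<in> webs n"
proof -
  have m: "w \<in> matchings n" using w by (simp add: webs_iff)
  obtain j where j: "{i, j} \<in> w" using matching_arc_exists[OF m, of i] i by auto
  obtain k where k: "{i + 1, k} \<in> w" using matching_arc_exists[OF m, of "i + 1"] i by auto
  have "{i, j} \<noteq> {i + 1, k}" using no j by (auto simp: doubleton_eq_iff)
  then obtain R where R: "w = insert {i, j} (insert {i + 1, k} R)" "finite R"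
    "\<Union>R \<inter> {i, j, i + 1, k} = {}" "distinct [i, j, i + 1, k]"
    using matching_two_arcs[OF m j k] by metis
  have notin: "{i, j} \<notin> R" "{i + 1, k} \<notin> R" using R(3) by auto
  have rec: "web_reconnect i w = insert {i, i + 1} (insert {j, k} R)"
    unfolding web_reconnect_def partner_eq[OF m j] partner_eq[OF m k] using notin by (subst R(1)) auto
  let ?v = "insert {i, i + 1} (insert {j, k} R)"
  have vm: "?v \<in> matchings n"
    using R(4) by (intro matching_replace_arcs[OF m[unfolded R(1)] R(3)]) auto
  have nocross: False
    if c: "p < r" "r < q" "q < s" and arcs: "{p, q} \<in> ?v" "{r, s} \<in> ?v" for p q r s
  proof -
    have side: "p < j \<and> j < q \<longleftrightarrow> p < k \<and> k < q" if e: "{p, q} \<in> R" "p < q" for p q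
    proof -
      have pq: "p \<notin> {i, j, i + 1, k}" "q \<notin> {i, j, i + 1, k}" proof -
        have "p \<in> \<Union>R" "q \<in> \<Union>R" using e by blast+
        then show "p \<notin> {i, j, i + 1, k}" "q \<notin> {i, j, i + 1, k}" using R(3) by blast+
      qed
      have ew: "{p, q} \<in> w" using e R(1) by simp
      have "p < i \<and> i < q \<longleftrightarrow> p < j \<and> j < q"
        by (rule web_same_side[OF w ew j _ _ e(2)]) (use pq in auto)
      moreover have "p < i + 1 \<and> i + 1 < q \<longleftrightarrow> p < k \<and> k < q"
        by (rule web_same_side[OF w ew k _ _ e(2)]) (use pq in auto)
      moreover have "p < i \<and> i < q \<longleftrightarrow> p < i + 1 \<and> i + 1 < q" using pq(1,2) by simp linarith
      ultimately show ?thesis by blast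
    qed
    have "{p, q} \<noteq> {i, i + 1}" "{r, s} \<noteq> {i, i + 1}" using c by (auto simp: doubleton_eq_iff)
    then have "{p, q} = {j, k} \<or> {p, q} \<in> R" "{r, s} = {j, k} \<or> {r, s} \<in> R"
      using arcs by (simp_all only: insert_iff simp_thms)
    then consider "{p, q} \<in> R" "{r, s} \<in> R" | "{p, q} \<in> R" "{r, s} = {j, k}"
      | "{p, q} = {j, k}" "{r, s} \<in> R" | "{p, q} = {j, k}" "{r, s} = {j, k}" by argo
    then show False
    proof cases
      case 1
      then have "{p, q} \<in> w" "{r, s} \<in> w" using R(1) by simp_all
      then show False using web_noncrossing[OF w] c by blast
    next
      case 2
      then show False using side[of p q] c by (auto simp: doubleton_eq_iff)
    next
      case 3
      then show False using side[of r s] c by (auto simp: doubleton_eq_iff)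
    next
      case 4
      then show False using c by (auto simp: doubleton_eq_iff)
    qed
  qed
  have "\<not> (\<exists>a b c d. a < b \<and> b < c \<and> c < d \<and> {a, c} \<in> ?v \<and> {b, d} \<in> ?v)"
    by (intro notI) (elim exE conjE, rule nocross)
  with vm have "?v \<in> webs n" unfolding webs_iff by (rule conjI)
  then have "web_reconnect i w \<in> webs n" by (simp only: rec)
  then show thesis by (rule that[OF R rec])
qed

lemma web_gen_act_basis_vec:
  "w \<in> webs n \<Longrightarrow> web_gen_act n i (basis_vec w) =
    (if {i, i + 1} \<in> w then - basis_vec w else basis_vec w + basis_vec (web_reconnect i w))"
  by (simp add: web_gen_act_def lin_ext_basis_vec finite_webs)

lemma web_gen_act_in_web_module:
  assumes x: "x \<in> web_module n" and i: "i \<in> {1..<2 * n}"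
  shows "web_gen_act n i x \<in> web_module n"
proof -
  have "web_gen_act n i ` basis_vec ` webs n \<subseteq> web_module n"
  proof clarify
    fix w assume w: "w \<in> webs n"
    have b: "basis_vec v \<in> web_module n" if "v \<in> webs n" for v
      using that unfolding web_module_def by (intro cfun.span_base imageI)
    show "web_gen_act n i (basis_vec w) \<in> web_module n"
    proof (cases "{i, i + 1} \<in> w")
      case True
      have "- basis_vec w \<in> web_module n"
        using b[OF w] unfolding web_module_def by (rule cfun.span_neg)
      then show ?thesis using True by (simp only: web_gen_act_basis_vec[OF w] if_True)
    next
      case False
      then have "web_reconnect i w \<in> webs n" using web_reconnectE[OF w i] by metis
      then have "basis_vec w + basis_vec (web_reconnect i w) \<in> web_module n"
        using b w unfolding web_module_def by (intro cfun.span_add) auto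
      then show ?thesis using False by (simp only: web_gen_act_basis_vec[OF w] if_False)
    qed
  qed
  moreover have "web_gen_act n i x \<in> cfun.span (web_gen_act n i ` basis_vec ` webs n)"
    unfolding web_gen_act_def lin_ext_image_span[symmetric]
    using x unfolding web_module_def by (rule imageI)
  ultimately show ?thesis
    using cfun.span_minimal[OF _ cfun.subspace_span] unfolding web_module_def by blast
qed

lemma adj_transp_permutes: "i \<in> {1..<2 * n} \<Longrightarrow> adj_transp i permutes {1..2 * n}"
  unfolding adj_transp_def by (intro permutes_swap_id) auto

lemma adj_transp_apply:
  "adj_transp i i = i + 1" "adj_transp i (i + 1) = i" "x \<noteq> i \<Longrightarrow> x \<noteq> i + 1 \<Longrightarrow> adj_transp i x = x"
  by (simp_all add: adj_transp_def)

text \<open>If \<open>(i, i + 1)\<close> is an arc, its bracket changes sign.  Otherwise the exchange turns the product of the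
  brackets of \<open>{i, j}\<close> and \<open>{i + 1, k}\<close> into that of \<open>{i + 1, j}\<close> and \<open>{i, k}\<close>, and the Pluecker relation
  expresses it by the old product and the brackets of \<open>(i, i + 1)\<close> and \<open>{j, k}\<close>.  The sign in front of the latter
  depends on the order of the points; noncrossing leaves three orders, and in all of them it is a plus.\<close>

lemma web_embedding_gen_act_basis_vec:
  assumes w: "w \<in> webs n" and i: "i \<in> {1..<2 * n}"
  shows "web_embedding n (web_gen_act n i (basis_vec w)) =
    specht_act n (adj_transp i) (web_embedding n (basis_vec w))"
proof -
  let ?s = "adj_transp i"
  have m: "w \<in> matchings n" using w by (simp add: webs_iff)
  have s: "?s permutes {1..2 * n}" using i by (rule adj_transp_permutes)
  obtain T where l: "lists_arcs n T w" using exists_lists_arcs[OF m] by blast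
  then have T: "T \<in> tableaux n" by (simp add: lists_arcs_def)
  define br where "br X = (\<lambda>a. of_bool (?s (Min a) \<in> first_row n X) -
      of_bool (?s (Max a) \<in> first_row n X) :: complex)" for X
  have "specht_act n ?s (web_embedding n (basis_vec w)) = specht_vec n (tab_perm n ?s T)"
    unfolding web_embedding_basis_vec[OF w] specht_vec_lists_arcs[OF l, symmetric]
    by (rule specht_act_specht_vec[OF T s])
  then have act: "specht_act n ?s (web_embedding n (basis_vec w)) X =
      (if X \<in> tabloid n ` tableaux n then prod (br X) w else 0)" for X
    by (simp only: specht_vec_tab_perm_lists_arcs[OF l s] br_def)
  have fixed: "br X a = bracket (first_row n X) a" if a: "a \<in> w" "i \<notin> a" "i + 1 \<notin> a" for X a
  proof -
    obtain p q where "a = {p, q}" "p < q" using matching_arcE[OF m a(1)] by metis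
    then show ?thesis using a by (auto simp: br_def bracket_def min_def max_def adj_transp_apply)
  qed
  have br_arc: "br X {p, q} = of_bool (?s p \<in> first_row n X) - of_bool (?s q \<in> first_row n X)"
    if "p < q" for X p q
    using that by (simp add: br_def min_def max_def)
  show ?thesis
  proof (cases "{i, i + 1} \<in> w")
    case True
    have "prod (br X) w = - prod (bracket (first_row n X)) w" for X
    proof -
      have "prod (br X) (w - {{i, i + 1}}) = prod (bracket (first_row n X)) (w - {{i, i + 1}})"
        using matching_disjoint[OF m True] by (intro prod.cong fixed) auto
      moreover have "br X {i, i + 1} = - bracket (first_row n X) {i, i + 1}"
        using br_arc[of i "i + 1" X] bracket_arc[of i "i + 1" "first_row n X"]
        by (simp add: adj_transp_apply(1) adj_transp_apply(2)[simplified])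
      ultimately show ?thesis
        using prod.remove[OF finite_matching[OF m] True, of "br X"]
          prod.remove[OF finite_matching[OF m] True, of "bracket (first_row n X)"] by simp
    qed
    moreover have "web_embedding n (- basis_vec w) = - matching_vec n w"
    proof -
      have "- basis_vec w = cscale (-1) (basis_vec w)" by (simp add: cscale_def fun_eq_iff)
      then have "web_embedding n (- basis_vec w) = cscale (-1) (web_embedding n (basis_vec w))"
        unfolding web_embedding_def lin_ext_scale[symmetric] by (rule arg_cong)
      then show ?thesis by (simp add: web_embedding_basis_vec[OF w] cscale_def fun_eq_iff)
    qed
    ultimately show ?thesis
      using True by (simp add: web_gen_act_basis_vec[OF w] fun_eq_iff act matching_vec_def)
  next
    case False
    obtain j k R where R: "w = insert {i, j} (insert {i + 1, k} R)" "finite R"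
      "\<Union>R \<inter> {i, j, i + 1, k} = {}" "distinct [i, j, i + 1, k]"
      and rec: "web_reconnect i w = insert {i, i + 1} (insert {j, k} R)" "web_reconnect i w \<in> webs n"
      using web_reconnectE[OF w i False] by metis
    have ne: "i \<noteq> j" "i \<noteq> k" "j \<noteq> i + 1" "k \<noteq> i + 1" "j \<noteq> k" using R(4) by auto
    have arcs: "{i, j} \<in> w" "{j, i} \<in> w" "{i + 1, k} \<in> w" "{k, i + 1} \<in> w"
      using R(1) by (auto simp: insert_commute)
    have nc: "\<not> (i + 1 < j \<and> j < k)" "\<not> (k < i \<and> i + 1 < j)" "\<not> (j < k \<and> k < i)"
      using web_noncrossing[OF w arcs(1) arcs(3)] web_noncrossing[OF w arcs(4) arcs(1)]
        web_noncrossing[OF w arcs(2) arcs(4)] by auto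
    have R': "\<Union>R \<inter> {i, i + 1, j, k} = {}" "distinct [i, i + 1, j, k]" using R(3,4) by auto
    \<comment> \<open>The Pluecker relation with its sign resolved by the noncrossing conditions.\<close>
    have key: "br X {i, j} * br X {i + 1, k} = bracket S {i, j} * bracket S {i + 1, k}
        + bracket S {i, i + 1} * bracket S {j, k}" if S: "S = first_row n X" for X S
    proof -
      have sj: "?s j = j" "?s k = k" using ne by (simp_all add: adj_transp_apply)
      have b: "br X {p, q} = (if p < q then of_bool (?s p \<in> S) - of_bool (?s q \<in> S)
          else of_bool (?s q \<in> S) - of_bool (?s p \<in> S))"
        "bracket S {p, q} = (if p < q then of_bool (p \<in> S) - of_bool (q \<in> S)
          else of_bool (q \<in> S) - of_bool (p \<in> S))" if "p \<noteq> q" for p q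
        using that br_arc[of p q X] br_arc[of q p X] bracket_arc[of p q S] bracket_arc[of q p S]
        by (auto simp: S insert_commute)
      define xi xi' xj xk :: complex where "xi = of_bool (i \<in> S)" and "xi' = of_bool (i + 1 \<in> S)"
        and "xj = of_bool (j \<in> S)" and "xk = of_bool (k \<in> S)"
      have e: "br X {i, j} = (if i < j then xi' - xj else xj - xi')"
        "br X {i + 1, k} = (if i + 1 < k then xi - xk else xk - xi)"
        "bracket S {i, j} = (if i < j then xi - xj else xj - xi)"
        "bracket S {i + 1, k} = (if i + 1 < k then xi' - xk else xk - xi')"
        "bracket S {i, i + 1} = xi - xi'"
        "bracket S {j, k} = (if j < k then xj - xk else xk - xj)"
        unfolding xi_def xi'_def xj_def xk_def b[OF ne(1)] b[OF ne(4)[symmetric]] b[OF ne(5)]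
          sj adj_transp_apply(1,2) by (simp_all add: bracket_arc)
      \<comment> \<open>Both partners on the right, one on each side, both on the left; noncrossing fixes the nesting.\<close>
      consider "i < j" "i + 1 < k" "k < j" | "j < i" "i + 1 < k" "j < k" | "j < i" "k < i" "k < j"
        using nc ne by linarith
      then show ?thesis unfolding e by cases (simp_all add: algebra_simps)
    qed
    have "prod (br X) w = prod (bracket (first_row n X)) w
        + prod (bracket (first_row n X)) (web_reconnect i w)" for X
    proof -
      have "prod (br X) R = prod (bracket (first_row n X)) R"
        using R(1,3) by (intro prod.cong fixed) auto
      then show ?thesis
        unfolding rec(1) prod_two_arcs[OF R(2) R'] by (subst (1 2) R(1))
          (simp only: prod_two_arcs[OF R(2-4)] key[OF HOL.refl] distrib_right)
    qed
    moreover have "web_embedding n (basis_vec w + basis_vec (web_reconnect i w)) =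
        matching_vec n w + matching_vec n (web_reconnect i w)"
      using web_embedding_basis_vec[OF w] web_embedding_basis_vec[OF rec(2)]
      by (simp only: web_embedding_def lin_ext_add)
    ultimately show ?thesis
      using False by (simp add: web_gen_act_basis_vec[OF w] fun_eq_iff act matching_vec_def)
  qed
qed

lemma web_embedding_gen_act:
  assumes x: "x \<in> web_module n" and i: "i \<in> {1..<2 * n}"
  shows "web_embedding n (web_gen_act n i x) = specht_act n (adj_transp i) (web_embedding n x)"
proof (rule linear_on_eq_on_span[where f = "\<lambda>x. web_embedding n (web_gen_act n i x)"
      and g = "\<lambda>x. specht_act n (adj_transp i) (web_embedding n x)" and S = "basis_vec ` webs n"])
  show "x \<in> cfun.span (basis_vec ` webs n)" using x by (simp only: web_module_def)
  show "linear_on (cfun.span (basis_vec ` webs n)) (\<lambda>x. web_embedding n (web_gen_act n i x))"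
    unfolding web_embedding_def web_gen_act_def
    by (intro linear_on_lin_ext_compose linear_on_lin_ext)
  show "linear_on (cfun.span (basis_vec ` webs n)) (\<lambda>x. specht_act n (adj_transp i) (web_embedding n x))"
    unfolding web_embedding_def specht_act_def
    by (intro linear_on_lin_ext_compose linear_on_lin_ext)
  show "web_embedding n (web_gen_act n i y) = specht_act n (adj_transp i) (web_embedding n y)"
    if "y \<in> basis_vec ` webs n" for y
    using that web_embedding_gen_act_basis_vec[OF _ i] by auto
qed

section \<open>Equivariance for the whole symmetric group\<close>

definition word_product :: "nat list \<Rightarrow> nat \<Rightarrow> nat" where
  "word_product is = foldr (\<lambda>i \<tau>. adj_transp i \<circ> \<tau>) is id"

lemma is_word_iff: "is_word n is \<sigma> \<longleftrightarrow> set is \<subseteq> {1..<2 * n} \<and> word_product is = \<sigma>"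
  by (simp only: is_word_def word_product_def)

lemma word_product_Nil: "word_product [] = id"
  by (simp add: word_product_def fun_eq_iff)

lemma word_product_Cons: "word_product (i # is) = adj_transp i \<circ> word_product is"
  by (simp add: word_product_def fun_eq_iff)

lemma word_product_append: "word_product (is @ js) = word_product is \<circ> word_product js"
  by (induction "is") (simp_all only: append.simps word_product_Nil word_product_Cons id_o o_assoc)

lemma is_word_compose: "is_word n is \<sigma> \<Longrightarrow> is_word n js \<tau> \<Longrightarrow> is_word n (is @ js) (\<sigma> \<circ> \<tau>)"
  unfolding is_word_iff by (simp only: word_product_append set_append Un_least simp_thms)

text \<open>Conjugating by \<open>s\<^bsub>b - 1\<^esub>\<close> moves the right end of the transposed pair one step to the left.\<close>

lemma exists_word_transpose:
  assumes "1 \<le> a" "a < b" "b \<le> 2 * n"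
  shows "\<exists>is. is_word n is (Transposition.transpose a b)"
  using assms
proof (induction "b - a" arbitrary: b rule: less_induct)
  case less
  show ?case
  proof (cases "b = a + 1")
    case True
    then have "is_word n [a] (Transposition.transpose a b)"
      using less.prems by (simp add: is_word_iff word_product_Cons word_product_Nil adj_transp_def)
    then show ?thesis by blast
  next
    case False
    define c where "c = b - 1"
    have c: "b = c + 1" "a < c" "c - a < b - a" using False less.prems by (auto simp: c_def)
    obtain "is" where "is": "is_word n is (Transposition.transpose a c)"
      using less.hyps[OF c(3)] c less.prems by auto
    have "is_word n [c] (adj_transp c)" using c less.prems by (simp add: is_word_iff word_product_Cons word_product_Nil)
    then have "is_word n (([c] @ is) @ [c]) ((adj_transp c \<circ> Transposition.transpose a c) \<circ> adj_transp c)"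
      using "is" by (intro is_word_compose)
    moreover have "(adj_transp c \<circ> Transposition.transpose a c) \<circ> adj_transp c = Transposition.transpose a b"
      using c by (auto simp: fun_eq_iff adj_transp_def Transposition.transpose_def)
    ultimately show ?thesis by metis
  qed
qed

lemma exists_word:
  assumes "\<sigma> permutes {1..2 * n}"
  shows "\<exists>is. is_word n is \<sigma>"
  using assms finite_atLeastAtMost
proof (induction rule: permutes_induct)
  case id
  have "is_word n [] id" by (simp add: is_word_iff word_product_Nil)
  then show ?case by blast
next
  case (swap a b p)
  have "\<exists>is. is_word n is (Transposition.transpose a b)"
  proof (cases "a < b")
    case True
    then show ?thesis using swap.hyps by (intro exists_word_transpose) auto
  next
    case False
    then have "\<exists>is. is_word n is (Transposition.transpose b a)"
      using swap.hyps by (intro exists_word_transpose) auto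
    then show ?thesis by (simp only: transpose_commute)
  qed
  then show ?case using swap.IH is_word_compose by blast
qed

lemma word_product_permutes: "set is \<subseteq> {1..<2 * n} \<Longrightarrow> word_product is permutes {1..2 * n}"
proof (induction "is")
  case Nil
  show ?case unfolding word_product_Nil by (rule permutes_id)
next
  case (Cons i "is")
  then have "i \<in> {1..<2 * n}" "set is \<subseteq> {1..<2 * n}" by simp_all
  then have "adj_transp i permutes {1..2 * n}" "word_product is permutes {1..2 * n}"
    using Cons.IH by (simp_all only: adj_transp_permutes)
  then have "adj_transp i \<circ> word_product is permutes {1..2 * n}" by (intro permutes_compose)
  then show ?case by (simp only: word_product_Cons)
qed

lemma specht_act_comp:
  assumes s: "\<sigma> permutes {1..2 * n}" and t: "\<tau> permutes {1..2 * n}" and x: "x \<in> specht_module n"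
  shows "specht_act n \<sigma> (specht_act n \<tau> x) = specht_act n (\<sigma> \<circ> \<tau>) x"
proof (rule linear_on_eq_on_span[where f = "\<lambda>x. specht_act n \<sigma> (specht_act n \<tau> x)"
      and g = "specht_act n (\<sigma> \<circ> \<tau>)" and S = "specht_vec n ` tableaux n"])
  show "specht_act n \<sigma> (specht_act n \<tau> y) = specht_act n (\<sigma> \<circ> \<tau>) y" if "y \<in> specht_vec n ` tableaux n" for y
    using that s t by (auto simp: specht_act_specht_vec tab_perm_in_tableaux tab_perm_tab_perm permutes_compose)
qed (use x in \<open>simp_all only: specht_module_def specht_act_def linear_on_lin_ext linear_on_lin_ext_compose\<close>)

lemma specht_act_id:
  assumes x: "x \<in> specht_module n"
  shows "specht_act n id x = x"
proof (rule linear_on_eq_on_span[where f = "specht_act n id" and g = "\<lambda>x. x" and S = "specht_vec n ` tableaux n"])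
  show "specht_act n id y = y" if "y \<in> specht_vec n ` tableaux n" for y
    using that by (auto simp: specht_act_specht_vec permutes_id tab_perm_id)
  show "linear_on (cfun.span (specht_vec n ` tableaux n)) (\<lambda>x. x)" by (simp add: linear_on_def)
qed (use x in \<open>simp_all only: specht_module_def specht_act_def linear_on_lin_ext\<close>)

lemma web_embedding_in_specht_module: "x \<in> web_module n \<Longrightarrow> web_embedding n x \<in> specht_module n"
  using web_embedding_image by blast

text \<open>The right-hand side of the second claim depends on the word only through its product.  Together with
  the injectivity of the embedding this makes the action on webs independent of the chosen word.\<close>

lemma web_embedding_word:
  assumes "set is \<subseteq> {1..<2 * n}" and x: "x \<in> web_module n"
  shows "foldr (web_gen_act n) is x \<in> web_module n"
    and "web_embedding n (foldr (web_gen_act n) is x) = specht_act n (word_product is) (web_embedding n x)"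
  using assms(1)
proof (induction "is")
  case Nil
  {
    case 1
    then show ?case using x by simp
  next
    case 2
    have "foldr (web_gen_act n) [] x = x" by simp
    then show ?case
      by (simp only: word_product_Nil specht_act_id[OF web_embedding_in_specht_module[OF x]])
  }
next
  case (Cons i "is")
  {
    case 1
    then show ?case using Cons.IH(1) by (simp add: web_gen_act_in_web_module)
  next
    case 2
    then have i: "i \<in> {1..<2 * n}" and "is": "set is \<subseteq> {1..<2 * n}" by simp_all
    have "web_embedding n (web_gen_act n i (foldr (web_gen_act n) is x)) =
        specht_act n (adj_transp i) (specht_act n (word_product is) (web_embedding n x))"
      by (simp only: web_embedding_gen_act[OF Cons.IH(1)[OF "is"] i] Cons.IH(2)[OF "is"])
    also have "\<dots> = specht_act n (adj_transp i \<circ> word_product is) (web_embedding n x)"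
      by (intro specht_act_comp adj_transp_permutes i word_product_permutes "is"
          web_embedding_in_specht_module x)
    finally have "web_embedding n (web_gen_act n i (foldr (web_gen_act n) is x)) =
        specht_act n (adj_transp i \<circ> word_product is) (web_embedding n x)" .
    moreover have "foldr (web_gen_act n) (i # is) x = web_gen_act n i (foldr (web_gen_act n) is x)"
      by simp
    ultimately show ?case by (simp only: word_product_Cons)
  }
qed

lemma
  assumes s: "\<sigma> permutes {1..2 * n}" and x: "x \<in> web_module n"
  shows web_act_in_web_module: "web_act n \<sigma> x \<in> web_module n"
    and web_embedding_web_act: "web_embedding n (web_act n \<sigma> x) = specht_act n \<sigma> (web_embedding n x)"
proof -
  define ws where "ws = (SOME is. is_word n is \<sigma>)"
  have "is_word n ws \<sigma>" unfolding ws_def using exists_word[OF s] by (rule someI_ex)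
  then have ws: "set ws \<subseteq> {1..<2 * n}" "word_product ws = \<sigma>" by (simp_all add: is_word_iff)
  have act: "web_act n \<sigma> x = foldr (web_gen_act n) ws x" by (simp add: web_act_def ws_def)
  show "web_act n \<sigma> x \<in> web_module n" unfolding act using ws(1) x by (rule web_embedding_word(1))
  show "web_embedding n (web_act n \<sigma> x) = specht_act n \<sigma> (web_embedding n x)"
    unfolding act using web_embedding_word(2)[OF ws(1) x] ws(2) by simp
qed

lemma web_act_adj_transp:
  assumes i: "i \<in> {1..<2 * n}" and x: "x \<in> web_module n"
  shows "web_act n (adj_transp i) x = web_gen_act n i x"
  using adj_transp_permutes[OF i] x web_act_in_web_module web_gen_act_in_web_module[OF x i]
  by (intro inj_onD[OF inj_on_web_embedding])
    (simp_all add: web_embedding_web_act web_embedding_gen_act[OF x i])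

section \<open>Paths in the tableau graph\<close>

lemma standard_tableauxD:
  assumes "T \<in> standard_tableaux n"
  shows "T \<in> tableaux n"
    and "r \<in> {1, 2} \<Longrightarrow> c \<in> {1..n} \<Longrightarrow> d \<in> {1..n} \<Longrightarrow> c < d \<Longrightarrow> T (r, c) < T (r, d)"
    and "c \<in> {1..n} \<Longrightarrow> T (1, c) < T (2, c)"
  using assms unfolding standard_tableaux_def by blast+

lemma T0_apply: "c \<in> {1..n} \<Longrightarrow> T0 n (1, c) = 2 * c - 1" "c \<in> {1..n} \<Longrightarrow> T0 n (2, c) = 2 * c"
  by (simp_all add: T0_def cells_def)

lemma lists_arcs_T0: "lists_arcs n (T0 n) (w0 n)"
proof -
  have "inj_on (T0 n) (cells n)"
  proof (rule inj_onI)
    fix x y assume x: "x \<in> cells n" and y: "y \<in> cells n" and eq: "T0 n x = T0 n y"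
    obtain r c where xr: "x = (r, c)" "r = 1 \<or> r = 2" "c \<ge> 1" using x by (auto simp: cells_def)
    obtain r' d where yr: "y = (r', d)" "r' = 1 \<or> r' = 2" "d \<ge> 1" using y by (auto simp: cells_def)
    have "(if r = 1 then 2 * c - 1 else 2 * c) = (if r' = 1 then 2 * d - 1 else 2 * d)"
      using x y eq unfolding xr(1) yr(1) T0_def by simp
    then show "x = y" using xr yr by (auto split: if_splits) presburger+
  qed
  moreover have "T0 n ` cells n = {1..2 * n}"
  proof (intro subset_antisym subsetI)
    fix x assume "x \<in> {1..2 * n}"
    then have "(if odd x then 1 else 2, (x + 1) div 2) \<in> cells n"
      "T0 n (if odd x then 1 else 2, (x + 1) div 2) = x"
      by (auto simp: T0_def cells_def elim: oddE evenE)
    then show "x \<in> T0 n ` cells n" by (metis imageI)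
  qed (auto simp: T0_def cells_def)
  ultimately have "T0 n \<in> tableaux n"
    unfolding tableaux_def bij_betw_def by (simp add: T0_def)
  moreover have "bij_betw (\<lambda>c. {T0 n (1, c), T0 n (2, c)}) {1..n} (w0 n)"
    unfolding bij_betw_def
  proof
    show "inj_on (\<lambda>c. {T0 n (1, c), T0 n (2, c)}) {1..n}"
      by (rule inj_onI) (auto simp: T0_apply doubleton_eq_iff simp del: One_nat_def)
    show "(\<lambda>c. {T0 n (1, c), T0 n (2, c)}) ` {1..n} = w0 n"
      unfolding w0_def by (auto simp: T0_apply simp del: One_nat_def)
  qed
  ultimately show ?thesis unfolding lists_arcs_def by (simp add: T0_apply del: One_nat_def)
qed

lemma T0_tableau: "T0 n \<in> tableaux n"
  using lists_arcs_T0 by (simp add: lists_arcs_def)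

lemma T0_standard: "T0 n \<in> standard_tableaux n"
  using T0_tableau unfolding standard_tableaux_def by (auto simp: T0_apply simp del: One_nat_def)

lemma w0_web: "w0 n \<in> webs n"
proof -
  have "w0 n \<in> matchings n"
    using columns_matching(1)[OF T0_tableau] lists_arcs_T0
    by (simp add: lists_arcs_def bij_betw_def)
  moreover have "\<not> (a < b \<and> b < c)" if "{a, c} \<in> w0 n" for a b c
  proof -
    obtain k where "{a, c} = {2 * k - 1, 2 * k}" using \<open>{a, c} \<in> w0 n\<close> unfolding w0_def by blast
    then show ?thesis by (auto simp: doubleton_eq_iff)
  qed
  ultimately show ?thesis unfolding webs_iff by blast
qed

lemma tab_path_product:
  assumes "tab_path n T \<sigma> U"
  shows "\<sigma> permutes {1..2 * n}" "tab_perm n \<sigma> T = U"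
  using assms
proof (induction rule: tab_path.induct)
  case refl
  {
    case 1
    show ?case by (rule permutes_id)
  next
    case 2
    show ?case using refl by (intro tab_perm_id standard_tableauxD(1))
  }
next
  case (step \<sigma> T' i T'')
  {
    case 1
    have "adj_transp i permutes {1..2 * n}"
      using step by (intro adj_transp_permutes) (simp add: tab_edge_def)
    then show ?case by (rule permutes_compose[OF step.IH(1)])
  next
    case 2
    have "tab_perm n (adj_transp i) (tab_perm n \<sigma> T) = T''" using step by (simp add: tab_edge_def)
    then show ?case by (simp only: tab_perm_tab_perm)
  }
qed

text \<open>Exchanging \<open>i\<close> and \<open>i + 1\<close> alters the order of no other pair of entries, and here this pair is neither in one
  row nor in one column.\<close>

lemma adj_transp_standard:
  assumes T: "T \<in> standard_tableaux n" and c: "c \<in> {1..n}" and d: "d \<in> {1..n}" and cd: "c \<noteq> d"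
    and i: "T (1, c) = i" "T (2, d) = i + 1"
  shows "tab_perm n (adj_transp i) T \<in> standard_tableaux n"
proof -
  note TT = standard_tableauxD[OF T]
  note eq = tableau_entry_eq_iff[OF TT(1)]
  have "i \<in> {1..<2 * n}"
    using tableau_entry[OF TT(1) _ c, of 1] tableau_entry[OF TT(1) _ d, of 2] i by simp
  then have "tab_perm n (adj_transp i) T \<in> tableaux n"
    using TT(1) by (intro tab_perm_in_tableaux adj_transp_permutes)
  moreover have mono: "adj_transp i x < adj_transp i y" if "x < y" "\<not> (x = i \<and> y = i + 1)" for x y
    using that by (auto simp: adj_transp_def Transposition.transpose_def)
  have "tab_perm n (adj_transp i) T (r, a) < tab_perm n (adj_transp i) T (r, b)"
    if "r \<in> {1, 2}" "a \<in> {1..n}" "b \<in> {1..n}" "a < b" for r a b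
  proof -
    have "\<not> (T (r, a) = i \<and> T (r, b) = i + 1)"
      using eq[of r a 1 c] eq[of r b 2 d] that c d i by auto
    then show ?thesis using mono TT(2)[OF that] that by (simp add: tab_perm_cell)
  qed
  moreover have "tab_perm n (adj_transp i) T (1, a) < tab_perm n (adj_transp i) T (2, a)" if a: "a \<in> {1..n}" for a
  proof -
    have "\<not> (T (1, a) = i \<and> T (2, a) = i + 1)"
      using eq[of 1 a 1 c] eq[of 2 a 2 d] a c d i cd by auto
    then show ?thesis using mono TT(3)[OF a] a by (simp add: tab_perm_cell)
  qed
  ultimately show ?thesis unfolding standard_tableaux_def by blast
qed

text \<open>The entries of the first row differ by at least \<open>2\<close>, start at \<open>1\<close> or later and end at \<open>2 * n - 1\<close> or earlier, which
  leaves no choice.\<close>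

lemma standard_consecutive_columns_eq_T0:
  assumes T: "T \<in> standard_tableaux n" and step: "\<And>c. c \<in> {1..n} \<Longrightarrow> T (2, c) = T (1, c) + 1"
  shows "T = T0 n"
proof -
  note TT = standard_tableauxD[OF T]
  have gap: "T (1, c) + 2 \<le> T (1, d)" if cd: "c \<in> {1..n}" "d \<in> {1..n}" "c < d" for c d
  proof -
    have "T (1, d) \<noteq> T (2, c)" using tableau_entry_eq_iff[OF TT(1), of 1 d 2 c] cd by simp
    then show ?thesis using TT(2)[of 1 c d] cd step[OF cd(1)] by simp
  qed
  have lower: "2 * c \<le> T (1, c) + 1" if "c \<in> {1..n}" for c
    using that
  proof (induction c)
    case (Suc c)
    show ?case
    proof (cases "c = 0")
      case True
      then show ?thesis using tableau_entry[OF TT(1), of 1 "Suc c"] Suc.prems by simp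
    next
      case False
      then show ?thesis using Suc gap[of c "Suc c"] by simp
    qed
  qed simp
  have upper: "T (1, c) + 1 \<le> 2 * c" if c: "c \<in> {1..n}" for c
  proof -
    \<comment> \<open>Induction from the last column downwards.\<close>
    have "T (1, n - m) + 1 \<le> 2 * (n - m)" if "m < n" for m
      using that
    proof (induction m)
      case 0
      then show ?case using tableau_entry[OF TT(1), of 2 n] step[of n] by simp
    next
      case (Suc m)
      moreover from Suc.prems have "n - Suc m \<in> {1..n}" "n - m \<in> {1..n}" "n - Suc m < n - m" by auto
      then have "T (1, n - Suc m) + 2 \<le> T (1, n - m)" by (rule gap)
      ultimately show ?case by simp
    qed
    from this[of "n - c"] show ?thesis using c by simp
  qed
  show ?thesis
  proof
    fix x
    show "T x = T0 n x"
    proof (cases "x \<in> cells n")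
      case True
      then obtain r c where rc: "x = (r, c)" "r = 1 \<or> r = 2" "c \<in> {1..n}" unfolding cells_def by blast
      have "T (1, c) = 2 * c - 1" using lower[OF rc(3)] upper[OF rc(3)] by simp
      then show ?thesis
        using rc step[OF rc(3)] by (auto simp: T0_apply simp del: One_nat_def)
    next
      case False
      then show ?thesis
        using TT(1) by (cases x) (simp add: tableaux_def extensional_def T0_def)
    qed
  qed
qed

text \<open>If there were no such pair, then going through the columns from the left, the predecessor of each
  second-row entry could only be the entry above it: were it in the second row, then it would be in an
  earlier column, and its own predecessor above it would leave no room for the first-row entry of the
  present column.\<close>

lemma standard_exists_descent:
  assumes T: "T \<in> standard_tableaux n" and ne: "T \<noteq> T0 n"
  obtains c d where "c \<in> {1..n}" "d \<in> {1..n}" "c \<noteq> d" "T (2, d) = T (1, c) + 1"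
proof -
  note TT = standard_tableauxD[OF T]
  have False if none: "\<And>c d. c \<in> {1..n} \<Longrightarrow> d \<in> {1..n} \<Longrightarrow> T (2, d) = T (1, c) + 1 \<Longrightarrow> c = d"
  proof -
    have "T (2, c) = T (1, c) + 1" if "c \<in> {1..n}" for c
      using that
    proof (induction c rule: less_induct)
      case (less c)
      define x where "x = T (2, c) - 1"
      have x: "T (2, c) = x + 1" "T (1, c) \<le> x" using TT(3)[OF less.prems] by (simp_all add: x_def)
      have "x \<in> {1..2 * n}"
        using tableau_entry[OF TT(1), of 1 c] tableau_entry[OF TT(1), of 2 c] less.prems x by simp
      then consider d where "d \<in> {1..n}" "x = T (1, d)" | d where "d \<in> {1..n}" "x = T (2, d)"
        by (rule tableau_entry_cases[OF TT(1)])
      then show ?case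
      proof cases
        case 1
        then show ?thesis using none[of d c] less.prems x by simp
      next
        case 2
        have "\<not> c \<le> d" using TT(2)[of 2 c d] 2 less.prems x by (cases "c = d") auto
        then have "T (2, d) = T (1, d) + 1" "T (1, d) < T (1, c)"
          using less.IH 2(1) less.prems TT(2)[of 1 d c] by simp_all
        moreover have "T (1, c) \<noteq> T (2, d)"
          using tableau_entry_eq_iff[OF TT(1), of 1 c 2 d] less.prems 2(1) by simp
        ultimately show ?thesis using x 2(2) by simp
      qed
    qed
    then show False using standard_consecutive_columns_eq_T0[OF T] ne by blast
  qed
  then show thesis using that by blast
qed

text \<open>A tableau other than \<open>T0 n\<close> has an incoming edge, and walking backwards along it decreases the sum of the
  second row.\<close>

lemma exists_tab_path:
  "T \<in> standard_tableaux n \<Longrightarrow> \<exists>\<sigma>. tab_path n (T0 n) \<sigma> T"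
proof (induction T rule: measure_induct_rule[where f = "\<lambda>T. \<Sum>c\<in>{1..n}. T (2, c)"])
  case (less T)
  note TT = standard_tableauxD[OF less.prems]
  show ?case
  proof (cases "T = T0 n")
    case True
    then show ?thesis using tab_path.refl[OF T0_standard] by blast
  next
    case False
    then obtain c d where cd: "c \<in> {1..n}" "d \<in> {1..n}" "c \<noteq> d" "T (2, d) = T (1, c) + 1"
      using standard_exists_descent[OF less.prems] by metis
    define i where "i = T (1, c)"
    define U where "U = tab_perm n (adj_transp i) T"
    have i: "T (1, c) = i" "T (2, d) = i + 1" using cd by (simp_all add: i_def)
    have U: "U \<in> standard_tableaux n"
      unfolding U_def by (rule adj_transp_standard[OF less.prems cd(1-3) i])
    have "(\<Sum>c\<in>{1..n}. U (2, c)) < (\<Sum>c\<in>{1..n}. T (2, c))"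
    proof (rule sum_strict_mono_ex1)
      have ni: "T (2, b) \<noteq> i" if "b \<in> {1..n}" for b
        using tableau_entry_eq_iff[OF TT(1), of 2 b 1 c] that cd(1) by (simp add: i_def)
      then show "\<forall>b\<in>{1..n}. U (2, b) \<le> T (2, b)"
        by (auto simp: U_def tab_perm_cell adj_transp_def Transposition.transpose_def)
      show "\<exists>b\<in>{1..n}. U (2, b) < T (2, b)"
        using cd(2) i by (intro bexI[of _ d]) (simp_all add: U_def tab_perm_cell adj_transp_def)
    qed simp
    then obtain \<sigma> where p: "tab_path n (T0 n) \<sigma> U" using less.IH U by blast
    have "i \<in> {1..<2 * n}"
      using tableau_entry[OF TT(1) _ cd(1), of 1] tableau_entry[OF TT(1) _ cd(2), of 2] i by simp
    moreover have "tab_perm n (adj_transp i) U = T"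
      using TT(1) by (simp add: U_def tab_perm_tab_perm adj_transp_def tab_perm_id)
    moreover have "i + 1 = U (1, c)" "i = U (2, d)"
      using i cd by (simp_all add: U_def tab_perm_cell adj_transp_def)
    then have "i + 1 \<in> U ` ({1} \<times> {1..n})" "i \<in> U ` ({2} \<times> {1..n})" using cd(1,2) by blast+
    ultimately have "tab_edge n U i T" using U less.prems by (simp add: tab_edge_def)
    then show ?thesis using tab_path.step[OF p] by blast
  qed
qed

section \<open>Equivariant isomorphisms\<close>

lemma web_embedding_w0: "web_embedding n (basis_vec (w0 n)) = specht_vec n (T0 n)"
  by (simp add: web_embedding_basis_vec[OF w0_web] specht_vec_lists_arcs[OF lists_arcs_T0])

lemma basis_vec_in_web_module: "w \<in> webs n \<Longrightarrow> basis_vec w \<in> web_module n"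
  unfolding web_module_def by (intro cfun.span_base imageI)

lemma web_embedding_path:
  assumes p: "tab_path n (T0 n) \<sigma> T"
  shows "web_embedding n (web_act n \<sigma> (basis_vec (w0 n))) = specht_vec n T"
  using tab_path_product[OF p] T0_tableau
  by (simp add: web_embedding_web_act basis_vec_in_web_module w0_web web_embedding_w0 specht_act_specht_vec)

text \<open>This one characterisation contains the independence of the path: all paths to \<open>T\<close> produce the unique web
  vector with image \<open>v\<^sub>T\<close>.\<close>

lemma is_phi_iff_inverse:
  "is_phi n \<phi> \<longleftrightarrow> linear_on (specht_module n) \<phi> \<and>
    (\<forall>x\<in>specht_module n. \<phi> x \<in> web_module n \<and> web_embedding n (\<phi> x) = x)"
proof
  assume phi: "is_phi n \<phi>"
  then have lin: "linear_on (specht_module n) \<phi>" and im: "\<phi> ` specht_module n \<subseteq> web_module n"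
    by (simp_all add: is_phi_def)
  have "web_embedding n (\<phi> x) = x" if x: "x \<in> specht_module n" for x
  proof (rule linear_on_eq_on_span[where f = "\<lambda>x. web_embedding n (\<phi> x)" and g = "\<lambda>x. x"
        and S = "specht_vec n ` standard_tableaux n"])
    show "linear_on (cfun.span (specht_vec n ` standard_tableaux n)) (\<lambda>x. web_embedding n (\<phi> x))"
      unfolding web_embedding_def specht_module_eq_span_standard[symmetric]
      by (rule linear_on_lin_ext_compose[OF lin])
    show "linear_on (cfun.span (specht_vec n ` standard_tableaux n)) (\<lambda>x. x)" by (simp add: linear_on_def)
    show "web_embedding n (\<phi> y) = y" if y: "y \<in> specht_vec n ` standard_tableaux n" for y
    proof -
      obtain T where T: "T \<in> standard_tableaux n" "y = specht_vec n T" using y by blast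
      obtain \<sigma> where p: "tab_path n (T0 n) \<sigma> T" using exists_tab_path[OF T(1)] by blast
      have "\<phi> y = web_act n \<sigma> (basis_vec (w0 n))" using phi T p unfolding is_phi_def by blast
      then show ?thesis using web_embedding_path[OF p] T(2) by simp
    qed
    show "x \<in> cfun.span (specht_vec n ` standard_tableaux n)"
      using x by (simp only: specht_module_eq_span_standard)
  qed
  then show "linear_on (specht_module n) \<phi> \<and>
    (\<forall>x\<in>specht_module n. \<phi> x \<in> web_module n \<and> web_embedding n (\<phi> x) = x)" using lin im by blast
next
  assume inv: "linear_on (specht_module n) \<phi> \<and>
    (\<forall>x\<in>specht_module n. \<phi> x \<in> web_module n \<and> web_embedding n (\<phi> x) = x)"
  have "\<phi> (specht_vec n T) = web_act n \<sigma> (basis_vec (w0 n))"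
    if T: "T \<in> standard_tableaux n" and p: "tab_path n (T0 n) \<sigma> T" for T \<sigma>
  proof (rule inj_onD[OF inj_on_web_embedding])
    have "specht_vec n T \<in> specht_module n"
      using T unfolding specht_module_eq_span_standard by (intro cfun.span_base imageI)
    then show "web_embedding n (\<phi> (specht_vec n T)) = web_embedding n (web_act n \<sigma> (basis_vec (w0 n)))"
      "\<phi> (specht_vec n T) \<in> web_module n" using inv web_embedding_path[OF p] by auto
    show "web_act n \<sigma> (basis_vec (w0 n)) \<in> web_module n"
      using tab_path_product(1)[OF p] by (intro web_act_in_web_module basis_vec_in_web_module w0_web)
  qed
  then show "is_phi n \<phi>" using inv unfolding is_phi_def by blast
qed

lemma exists_is_phi: "\<exists>\<phi>. is_phi n \<phi>"
proof -
  define \<phi> where "\<phi> = inv_into (web_module n) (web_embedding n)"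
  have phi: "\<phi> x \<in> web_module n" "web_embedding n (\<phi> x) = x" if "x \<in> specht_module n" for x
    using that unfolding \<phi>_def web_embedding_image[symmetric]
    by (simp_all add: inv_into_into f_inv_into_f)
  have left: "\<phi> (web_embedding n y) = y" if "y \<in> web_module n" for y
    unfolding \<phi>_def using inj_on_web_embedding that by (rule inv_into_f_f)
  have "\<phi> (x + y) = \<phi> x + \<phi> y" if "x \<in> specht_module n" "y \<in> specht_module n" for x y
  proof -
    have "\<phi> x + \<phi> y \<in> web_module n"
      using phi(1)[OF that(1)] phi(1)[OF that(2)] unfolding web_module_def by (rule cfun.span_add)
    moreover have "web_embedding n (\<phi> x + \<phi> y) = x + y"
      using phi(2)[OF that(1)] phi(2)[OF that(2)] unfolding web_embedding_def lin_ext_add by (simp only:)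
    ultimately show ?thesis using left by metis
  qed
  moreover have "\<phi> (cscale c x) = cscale c (\<phi> x)" if "x \<in> specht_module n" for c x
  proof -
    have "cscale c (\<phi> x) \<in> web_module n"
      using phi(1)[OF that] unfolding web_module_def by (rule cfun.span_scale)
    moreover have "web_embedding n (cscale c (\<phi> x)) = cscale c x"
      using phi(2)[OF that] unfolding web_embedding_def lin_ext_scale by (simp only:)
    ultimately show ?thesis using left by metis
  qed
  ultimately have "linear_on (specht_module n) \<phi>" unfolding linear_on_def by blast
  then show ?thesis using phi is_phi_iff_inverse by blast
qed

lemma specht_act_in_specht_module:
  assumes s: "\<sigma> permutes {1..2 * n}" and x: "x \<in> specht_module n"
  shows "specht_act n \<sigma> x \<in> specht_module n"
proof -
  obtain y where "y \<in> web_module n" "x = web_embedding n y" using x web_embedding_image by blast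
  then show ?thesis
    using web_embedding_in_specht_module[OF web_act_in_web_module[OF s]] web_embedding_web_act[OF s] by metis
qed

lemma is_phi_equivariant_iso:
  assumes phi: "is_phi n \<phi>"
  shows "equivariant_iso n \<phi>"
proof -
  have lin: "linear_on (specht_module n) \<phi>" using phi unfolding is_phi_iff_inverse by blast
  have inv: "\<phi> x \<in> web_module n" "web_embedding n (\<phi> x) = x" if "x \<in> specht_module n" for x
    using phi that unfolding is_phi_iff_inverse by blast+
  have left: "\<phi> (web_embedding n y) = y" if y: "y \<in> web_module n" for y
    using inv[OF web_embedding_in_specht_module[OF y]] y
    by (intro inj_onD[OF inj_on_web_embedding]) auto
  have "bij_betw \<phi> (specht_module n) (web_module n)"
    by (rule bij_betwI[of _ _ _ "web_embedding n"])
      (auto simp: inv left web_embedding_in_specht_module)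
  moreover have "equivariant n \<phi>"
    unfolding equivariant_def
  proof (intro allI impI ballI)
    fix \<sigma> x assume s: "\<sigma> permutes {1..2 * n}" and x: "x \<in> specht_module n"
    have "specht_act n \<sigma> x = web_embedding n (web_act n \<sigma> (\<phi> x))"
      by (simp add: web_embedding_web_act[OF s] inv x)
    then show "\<phi> (specht_act n \<sigma> x) = web_act n \<sigma> (\<phi> x)"
      by (simp add: left web_act_in_web_module[OF s] inv x)
  qed
  ultimately show ?thesis using lin by (simp add: equivariant_iso_def)
qed

text \<open>All webs produced by \<open>s\<^sub>i\<close>, apart from the argument itself, contain the arc \<open>(i, i + 1)\<close>.\<close>

lemma web_gen_act_apply_no_arc:
  assumes x: "x \<in> web_module n" and w: "w \<in> webs n" and no: "{i, i + 1} \<notin> w"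
  shows "web_gen_act n i x w = x w"
proof -
  have "web_gen_act n i x w = (\<Sum>v\<in>webs n. if v = w then x v else 0)"
    unfolding web_gen_act_def lin_ext_def sum_apply
  proof (intro sum.cong HOL.refl)
    fix v assume "v \<in> webs n"
    have "{i, i + 1} \<in> web_reconnect i v" by (simp add: web_reconnect_def)
    then have "web_reconnect i v \<noteq> w" using no by blast
    then show "cscale (x v) (if {i, i + 1} \<in> v then - basis_vec v
        else basis_vec v + basis_vec (web_reconnect i v)) w = (if v = w then x v else 0)"
      using no by (auto simp: cscale_def basis_vec_def)
  qed
  then show ?thesis using w finite_webs by simp
qed

text \<open>The coefficient of a web without the arc \<open>(2 * k - 1, 2 * k)\<close> is both preserved and negated, so it vanishes; the
  only web containing all these arcs is \<open>w\<^sub>0\<close>.\<close>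

lemma antisymmetric_web_vector:
  assumes x: "x \<in> web_module n"
    and anti: "\<And>k. k \<in> {1..n} \<Longrightarrow> web_gen_act n (2 * k - 1) x = cscale (-1) x"
  shows "x = cscale (x (w0 n)) (basis_vec (w0 n))"
proof
  fix w
  have "x w = 0" if ne: "w \<noteq> w0 n"
  proof (cases "w \<in> webs n")
    case True
    have "\<not> w0 n \<subseteq> w" using matching_subset_eq[of "w0 n" n w] w0_web[of n] True ne by (auto simp: webs_iff)
    then obtain k where k: "k \<in> {1..n}" "{2 * k - 1, 2 * k - 1 + 1} \<notin> w" unfolding w0_def by auto
    show ?thesis
      using web_gen_act_apply_no_arc[OF x True k(2)] anti[OF k(1)] by (simp add: cscale_def)
  next
    case False
    then show ?thesis using x web_module_iff by blast
  qed
  then show "x w = cscale (x (w0 n)) (basis_vec (w0 n)) w" by (simp add: cscale_def basis_vec_def)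
qed

lemma w0_antisymmetric:
  assumes k: "k \<in> {1..n}"
  shows "web_gen_act n (2 * k - 1) (basis_vec (w0 n)) = cscale (-1) (basis_vec (w0 n))"
proof -
  have "{2 * k - 1, 2 * k - 1 + 1} = {2 * k - 1, 2 * k}" using k by simp
  then have "{2 * k - 1, 2 * k - 1 + 1} \<in> w0 n" using k unfolding w0_def by blast
  then show ?thesis by (simp add: web_gen_act_basis_vec[OF w0_web] cscale_def fun_eq_iff)
qed

theorem corollary5p4:
  fixes n :: nat
  assumes "n \<ge> 1"
  shows "(\<exists>\<phi>. is_phi n \<phi>) \<and>
    (\<forall>\<phi>. is_phi n \<phi> \<longrightarrow>
       equivariant_iso n \<phi> \<and>
       (\<forall>\<psi>. equivariant_iso n \<psi> \<longrightarrow>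
          (\<exists>c. c \<noteq> 0 \<and> (\<forall>x\<in>specht_module n. \<psi> x = cscale c (\<phi> x)))))"
proof (intro conjI allI impI exists_is_phi)
  fix \<phi> assume phi: "is_phi n \<phi>"
  show iso: "equivariant_iso n \<phi>" using phi by (rule is_phi_equivariant_iso)
  fix \<psi> assume psi: "equivariant_iso n \<psi>"
  let ?v = "specht_vec n (T0 n)" and ?e = "basis_vec (w0 n)"
  have v: "?v \<in> specht_module n" using T0_tableau unfolding specht_module_def by (intro cfun.span_base imageI)
  have e: "?e \<in> web_module n" by (intro basis_vec_in_web_module w0_web)
  have lin: "linear_on (specht_module n) \<phi>" "linear_on (specht_module n) \<psi>"
    and bij: "bij_betw \<psi> (specht_module n) (web_module n)"
    using iso psi by (simp_all add: equivariant_iso_def)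
  have equi: "\<phi> (specht_act n \<sigma> x) = web_act n \<sigma> (\<phi> x)" "\<psi> (specht_act n \<sigma> x) = web_act n \<sigma> (\<psi> x)"
    if "\<sigma> permutes {1..2 * n}" "x \<in> specht_module n" for \<sigma> x
    using iso psi that by (simp_all add: equivariant_iso_def equivariant_def)
  have phi_v: "\<phi> ?v = ?e"
    using phi v e web_embedding_w0 unfolding is_phi_iff_inverse
    by (intro inj_onD[OF inj_on_web_embedding]) auto
  have psi_v: "\<psi> ?v \<in> web_module n" using bij_betwE[OF bij] v by blast
  define c where "c = \<psi> ?v (w0 n)"
  have "web_gen_act n (2 * k - 1) (\<psi> ?v) = cscale (-1) (\<psi> ?v)" if k: "k \<in> {1..n}" for k
  proof -
    have i: "2 * k - 1 \<in> {1..<2 * n}" using k by auto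
    note s = adj_transp_permutes[OF i]
    have "specht_act n (adj_transp (2 * k - 1)) ?v = web_embedding n (web_gen_act n (2 * k - 1) ?e)"
      by (simp only: web_embedding_gen_act[OF e i] web_embedding_w0)
    also have "\<dots> = cscale (-1) ?v"
      by (simp only: w0_antisymmetric[OF k] web_embedding_def lin_ext_scale)
        (simp only: web_embedding_w0[unfolded web_embedding_def])
    finally have "web_act n (adj_transp (2 * k - 1)) (\<psi> ?v) = \<psi> (cscale (-1) ?v)"
      using equi(2)[OF s v] by simp
    then show ?thesis
      using lin(2) v web_act_adj_transp[OF i psi_v] unfolding linear_on_def by metis
  qed
  then have c: "\<psi> ?v = cscale c ?e" unfolding c_def by (rule antisymmetric_web_vector[OF psi_v])
  have "c \<noteq> 0"
  proof
    assume "c = 0"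
    then have "\<psi> ?v = \<psi> (cscale 0 ?v)" using c lin(2) v unfolding linear_on_def by (metis cfun.scale_zero_left)
    moreover have "cscale 0 ?v \<in> specht_module n"
      using v unfolding specht_module_def by (rule cfun.span_scale)
    ultimately have "?v = cscale 0 ?v" using inj_onD[OF bij_betw_imp_inj_on[OF bij]] v by blast
    then have "?e = 0"
      using web_embedding_w0 web_embedding_eq_0[OF e] by (metis cfun.scale_zero_left)
    then have "?e (w0 n) = 0" by (simp only: zero_fun_apply)
    then show False by (simp add: basis_vec_def)
  qed
  moreover have "\<psi> x = cscale c (\<phi> x)" if x: "x \<in> specht_module n" for x
  proof (rule linear_on_eq_on_span[where f = \<psi> and g = "\<lambda>x. cscale c (\<phi> x)"
        and S = "specht_vec n ` standard_tableaux n"])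
    show "linear_on (cfun.span (specht_vec n ` standard_tableaux n)) \<psi>"
      using lin(2) by (simp only: specht_module_eq_span_standard)
    have "linear_on (specht_module n) (\<lambda>x. cscale c (\<phi> x))"
      using lin(1) by (simp add: linear_on_def cfun.scale_right_distrib cfun.scale_left_commute)
    then show "linear_on (cfun.span (specht_vec n ` standard_tableaux n)) (\<lambda>x. cscale c (\<phi> x))"
      by (simp only: specht_module_eq_span_standard)
    show "x \<in> cfun.span (specht_vec n ` standard_tableaux n)"
      using x by (simp only: specht_module_eq_span_standard)
    show "\<psi> y = cscale c (\<phi> y)" if y: "y \<in> specht_vec n ` standard_tableaux n" for y
    proof -
      obtain T where T: "T \<in> standard_tableaux n" "y = specht_vec n T" using y by blast
      obtain \<sigma> where p: "tab_path n (T0 n) \<sigma> T" using exists_tab_path[OF T(1)] by blast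
      note s = tab_path_product[OF p]
      have y: "y = specht_act n \<sigma> ?v" using specht_act_specht_vec[OF T0_tableau s(1)] s(2) T(2) by simp
      have cv: "cscale c ?v \<in> specht_module n"
        using v unfolding specht_module_def by (rule cfun.span_scale)
      have "\<psi> ?v = \<phi> (cscale c ?v)"
        using lin(1) v unfolding linear_on_def by (simp add: c phi_v)
      then have "\<psi> y = \<phi> (specht_act n \<sigma> (cscale c ?v))"
        unfolding y using equi(1)[OF s(1) cv] equi(2)[OF s(1) v] by simp
      also have "specht_act n \<sigma> (cscale c ?v) = cscale c y"
        unfolding y specht_act_def by (rule lin_ext_scale)
      also have "\<phi> (cscale c y) = cscale c (\<phi> y)"
        using lin(1) specht_act_in_specht_module[OF s(1) v] unfolding y linear_on_def by blast
      finally show ?thesis .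
    qed
  qed
  ultimately show "\<exists>c. c \<noteq> 0 \<and> (\<forall>x\<in>specht_module n. \<psi> x = cscale c (\<phi> x))" by blast
qed

end
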